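(* Let $\mathcal{H}$ be a real Hilbert space, let $A\colon\mathcal{H}\to 2^{\mathcal{H}}$ be maximally monotone, and let $B\colon\mathcal{H}\to\mathcal{H}$ be monotone and $\mu_0$-Lipschitzian for some $\mu_0\in[0,+\infty[$. Let $m$ be a strictly positive integer and let $(\mathcal{G}_i)_{1\leq i\leq m}$ be real Hilbert spaces. For every $i\in\{1,\ldots,m\}$, let $A_i\colon\mathcal{G}_i\to 2^{\mathcal{G}_i}$ be maximally monotone, let $B_i\colon\mathcal{G}_i\to 2^{\mathcal{G}_i}$ be maximally monotone and such that $B_i^{-1}$ is a $\mu_i$-Lipschitzian operator $\mathcal{G}_i\to\mathcal{G}_i$ for some $\mu_i\in[0,+\infty[$, and let $L_i\colon\mathcal{H}\to\mathcal{G}_i$ be a bounded linear operator, where $\sum_{i=1}^m\|L_i\|^2\neq 0$. Suppose that $$0\in\operatorname{ran}\Big(A+\sum_{i=1}^m L_i^*(A_i\,\square\,B_i)L_i+B\Big).$$ Consider the primal inclusion: find $\overline{x}\in\mathcal{H}$ such that $$0\in A\overline{x}+\sum_{i=1}^m L_i^*(A_i\,\square\,B_i)L_i\overline{x}+B\overline{x},\qquad\text{(P)}$$ and the dual inclusion: find $(\overline{v}_1,\ldots,\overline{v}_m)\in\mathcal{G}_1\times\cdots\times\mathcal{G}_m$ such that $$(\forall i\in\{1,\ldots,m\})\qquad 0\in -L_i(A+B)^{-1}\Big(-\sum_{j=1}^m L_j^*\overline{v}_j\Big)+A_i^{-1}\overline{v}_i+B_i^{-1}\overline{v}_i.\qquad\text{(D)}$$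 Set $$\mu=\max\{\mu_0,\ldots,\mu_m\}+\sqrt{\sum_{i=1}^m\|L_i\|^2}.$$ Let $\gamma\in\,]0,(\sqrt{2}-1)/\mu[$, let $(x_0,x_{-1})\in\mathcal{H}^2$ and, for every $i\in\{1,\ldots,m\}$, let $(v_{i,0},v_{i,-1})\in\mathcal{G}_i^2$. Iterate, for every $n\in\mathbb{N}$, $$x_{n+1}=J_{\gamma A}\Big(x_n-\gamma B(2x_n-x_{n-1})-\gamma\sum_{i=1}^m L_i^*(2v_{i,n}-v_{i,n-1})\Big),$$ and, for every $i\in\{1,\ldots,m\}$, $$v_{i,n+1}=J_{\gamma A_i^{-1}}\Big(v_{i,n}-\gamma B_i^{-1}(2v_{i,n}-v_{i,n-1})+\gamma L_i(2x_n-x_{n-1})\Big).$$ Then $(x_n)_{n\in\mathbb{N}}$ converges weakly to some $\overline{x}$ that solves (P), and $((v_{1,n},\ldots,v_{m,n}))_{n\in\mathbb{N}}$ converges weakly to some $(\overline{v}_1,\ldots,\overline{v}_m)$ that solves (D).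
   Context: $\mathbb{N}=\{0,1,2,\dots\}$. Let $\mathcal{H}$ be a real Hilbert space with inner product $\langle\cdot\mid\cdot\rangle$ and norm $\|\cdot\|$. A set-valued operator $A\colon\mathcal{H}\to 2^{\mathcal{H}}$ has graph $\operatorname{gra}(A)=\{(x,u): u\in Ax\}$, range $\operatorname{ran}(A)=\{u\in\mathcal{H}:(\exists x\in\mathcal{H})\ u\in Ax\}$, and inverse $A^{-1}\colon u\mapsto\{x: u\in Ax\}$. It is monotone if $\langle x-y\mid u-v\rangle\geq 0$ for all $(x,u),(y,v)\in\operatorname{gra}(A)$, and maximally monotone if it is monotone and there is no monotone operator whose graph properly contains $\operatorname{gra}(A)$. The resolvent of $A$ is $J_A=(\operatorname{Id}+A)^{-1}$, which is single-valued and defined everywhere when $A$ is maximally monotone; thus $J_{\gamma A}=(\operatorname{Id}+\gamma A)^{-1}$. The parallel sum of two set-valued operators $A$ and $B$ on the same space is $A\,\square\,B=(A^{-1}+B^{-1})^{-1}$. Sums of set-valued operators are pointwise Minkowski sums, and for a set $S$, $L_i(S)$ denotes the image of $S$ under $L_i$. A single-valued operator $T$ is $\mu$-Lipschitzian if $\|Tx-Ty\|\leq\mu\|x-y\|$ for all $x,y$ in the space. $L_i^*$ is the adjoint of $L_i$. Weak convergence of $(v_{1,n},\ldots,v_{m,n})$ is in the Hilbert direct sum $\mathcal{G}_1\oplus\cdots\oplus\mathcal{G}_m$. *)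

theory Defs
  imports "HOL-Analysis.Analysis"
begin

text \<open>
  A set-valued operator on a space is a function \<open>A :: 'a \<Rightarrow> 'a set\<close>; sums of operators are pointwise
  Minkowski sums (\<open>HOL-Library.Set_Algebras\<close>).

  A finite family of Hilbert spaces \<open>(\<G>\<^sub>i)\<close> with unrelated dimensions cannot be given by a family of
  types.  Each \<open>\<G>\<^sub>i\<close> is therefore a complete linear subspace \<open>S\<close> of one real inner product space
  \<open>'a\<close>, with the inherited inner product; any family of Hilbert spaces arises in this way inside
  its direct sum.  An operator on \<open>S\<close> is an \<open>A :: 'a \<Rightarrow> 'a set\<close> whose graph lies in \<open>S \<times> S\<close>, so that
  \<open>A x = {}\<close> for \<open>x\<close> outside \<open>S\<close>.
\<close>

definition gra_op :: "('a \<Rightarrow> 'b set) \<Rightarrow> ('a \<times> 'b) set" where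
  "gra_op A = {(x, u). u \<in> A x}"

definition ran_op :: "('a \<Rightarrow> 'b set) \<Rightarrow> 'b set" where
  "ran_op A = {u. \<exists>x. u \<in> A x}"

definition inv_op :: "('a \<Rightarrow> 'b set) \<Rightarrow> 'b \<Rightarrow> 'a set" where
  "inv_op A u = {x. u \<in> A x}"

definition monotone_op :: "('a::real_inner \<Rightarrow> 'a set) \<Rightarrow> bool" where
  "monotone_op A \<longleftrightarrow> (\<forall>(x, u) \<in> gra_op A. \<forall>(y, v) \<in> gra_op A. (x - y) \<bullet> (u - v) \<ge> 0)"

definition maximally_monotone_on :: "'a::real_inner set \<Rightarrow> ('a \<Rightarrow> 'a set) \<Rightarrow> bool" where
  "maximally_monotone_on S A \<longleftrightarrow>
     gra_op A \<subseteq> S \<times> S \<and> monotone_op A \<and>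
     (\<nexists>C. gra_op C \<subseteq> S \<times> S \<and> monotone_op C \<and> gra_op A \<subset> gra_op C)"

definition scale_op :: "real \<Rightarrow> ('a::real_vector \<Rightarrow> 'a set) \<Rightarrow> 'a \<Rightarrow> 'a set" where
  "scale_op c A x = (\<lambda>u. c *\<^sub>R u) ` A x"

definition parallel_sum :: "('a::plus \<Rightarrow> 'a set) \<Rightarrow> ('a \<Rightarrow> 'a set) \<Rightarrow> 'a \<Rightarrow> 'a set" where
  "parallel_sum A B = inv_op (\<lambda>u. inv_op A u + inv_op B u)"

text \<open>
  \<open>value_op T\<close> reads a set-valued operator as a function; it is meaningful only at points
  where \<open>T\<close> is single-valued.
\<close>

definition value_op :: "('a \<Rightarrow> 'b set) \<Rightarrow> 'a \<Rightarrow> 'b" where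
  "value_op T x = the_elem (T x)"

definition lipschitzian_op_on :: "real \<Rightarrow> 'a::metric_space set \<Rightarrow> ('a \<Rightarrow> 'a set) \<Rightarrow> bool" where
  "lipschitzian_op_on c S T \<longleftrightarrow>
     (\<forall>x\<in>S. \<exists>y\<in>S. T x = {y}) \<and> c-lipschitz_on S (value_op T)"

text \<open>
  For an operator on a subspace \<open>S\<close>, \<open>{x} + A x\<close> is empty outside \<open>S\<close>, so the same definition
  gives the resolvent with respect to \<open>S\<close>.
\<close>

definition resolvent :: "('a::real_vector \<Rightarrow> 'a set) \<Rightarrow> 'a \<Rightarrow> 'a" where
  "resolvent A = value_op (inv_op (\<lambda>x. {x} + A x))"

definition weakly_converges :: "(nat \<Rightarrow> 'a::real_inner) \<Rightarrow> 'a \<Rightarrow> bool" where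
  "weakly_converges x l \<longleftrightarrow> (\<forall>w. (\<lambda>n. x n \<bullet> w) \<longlonglongrightarrow> l \<bullet> w)"

text \<open>
  Weak convergence in the Hilbert direct sum of \<open>(G i)\<^sub>i\<^sub>\<in>\<^sub>I\<close> (\<open>I\<close> finite), whose elements
  are the families \<open>v\<close> with \<open>v i \<in> G i\<close> and whose inner product is \<open>\<Sum>i\<in>I. v i \<bullet> w i\<close>.
\<close>

definition weakly_converges_direct_sum ::
  "'i set \<Rightarrow> ('i \<Rightarrow> 'a::real_inner set) \<Rightarrow> (nat \<Rightarrow> 'i \<Rightarrow> 'a) \<Rightarrow> ('i \<Rightarrow> 'a) \<Rightarrow> bool" where
  "weakly_converges_direct_sum I G v l \<longleftrightarrow>
     (\<forall>n. v n \<in> Pi I G) \<and> l \<in> Pi I G \<and>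
     (\<forall>w \<in> Pi I G. (\<lambda>n. \<Sum>i\<in>I. v n i \<bullet> w i) \<longlonglongrightarrow> (\<Sum>i\<in>I. l i \<bullet> w i))"

text \<open>
  For \<open>L i\<close> with values in the subspace \<open>\<G>\<^sub>i\<close>, the restriction of \<open>adjoint (L i)\<close> to \<open>\<G>\<^sub>i\<close> is the
  adjoint of \<open>L i\<close> as an operator into \<open>\<G>\<^sub>i\<close>; below it is only applied to elements of \<open>\<G>\<^sub>i\<close>.
\<close>

definition primal_op ::
  "nat \<Rightarrow> ('h::real_inner \<Rightarrow> 'h set) \<Rightarrow> ('h \<Rightarrow> 'h) \<Rightarrow> (nat \<Rightarrow> 'g::real_inner \<Rightarrow> 'g set) \<Rightarrow>
   (nat \<Rightarrow> 'g \<Rightarrow> 'g set) \<Rightarrow> (nat \<Rightarrow> 'h \<Rightarrow> 'g) \<Rightarrow> 'h \<Rightarrow> 'h set" where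
  "primal_op m A B As Bs L x =
     A x + (\<Sum>i=1..m. adjoint (L i) ` parallel_sum (As i) (Bs i) (L i x)) + {B x}"

definition solves_primal ::
  "nat \<Rightarrow> ('h::real_inner \<Rightarrow> 'h set) \<Rightarrow> ('h \<Rightarrow> 'h) \<Rightarrow> (nat \<Rightarrow> 'g::real_inner \<Rightarrow> 'g set) \<Rightarrow>
   (nat \<Rightarrow> 'g \<Rightarrow> 'g set) \<Rightarrow> (nat \<Rightarrow> 'h \<Rightarrow> 'g) \<Rightarrow> 'h \<Rightarrow> bool" where
  "solves_primal m A B As Bs L x \<longleftrightarrow> 0 \<in> primal_op m A B As Bs L x"

definition solves_dual ::
  "nat \<Rightarrow> (nat \<Rightarrow> 'g::real_inner set) \<Rightarrow> ('h::real_inner \<Rightarrow> 'h set) \<Rightarrow> ('h \<Rightarrow> 'h) \<Rightarrow>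
   (nat \<Rightarrow> 'g \<Rightarrow> 'g set) \<Rightarrow> (nat \<Rightarrow> 'g \<Rightarrow> 'g set) \<Rightarrow> (nat \<Rightarrow> 'h \<Rightarrow> 'g) \<Rightarrow> (nat \<Rightarrow> 'g) \<Rightarrow> bool" where
  "solves_dual m G A B As Bs L v \<longleftrightarrow>
     (\<forall>i\<in>{1..m}. v i \<in> G i \<and>
        0 \<in> (\<lambda>x. - L i x) ` inv_op (\<lambda>x. A x + {B x}) (- (\<Sum>j=1..m. adjoint (L j) (v j)))
             + inv_op (As i) (v i) + inv_op (Bs i) (v i))"

end

theory Submission
  imports Defs "HOL-Library.Poly_Mapping"
begin

text \<open>
  On \<open>\<H> \<oplus> \<G>\<^sub>1 \<oplus> \<dots> \<oplus> \<G>\<^sub>m\<close> put \<open>M (x, v) = A x \<times> \<Prod>\<^sub>i A\<^sub>i\<inverse> v\<^sub>i\<close> and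
  \<open>Q (x, v) = (B x + \<Sum>\<^sub>i L\<^sub>i\<^sup>* v\<^sub>i, (B\<^sub>i\<inverse> v\<^sub>i - L\<^sub>i x)\<^sub>i)\<close>. The linear part of \<open>Q\<close> is skew, so \<open>Q\<close> is monotone, and it
  is \<open>\<mu>\<close>-Lipschitzian. The iteration becomes the reflected forward-backward step
  \<open>z\<^sub>n\<^sub>+\<^sub>1 = J (z\<^sub>n - \<gamma> Q (2 z\<^sub>n - z\<^sub>n\<^sub>-\<^sub>1))\<close> with \<open>J\<close> the resolvent of \<open>\<gamma> M\<close>, and the zeros of \<open>M + Q\<close> are pairs
  of primal and dual solutions. With \<open>y\<^sub>n = 2 z\<^sub>n - z\<^sub>n\<^sub>-\<^sub>1\<close>, \<open>u\<^sub>n = (z\<^sub>n\<^sub>-\<^sub>1 - z\<^sub>n) / \<gamma> - Q y\<^sub>n\<^sub>-\<^sub>1 \<in> M z\<^sub>n\<close> and \<open>p\<close> a zero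
  of \<open>M + Q\<close>, the energy
  \<open>\<parallel>z\<^sub>n - p\<parallel>\<^sup>2 - 2 \<gamma> (u\<^sub>n + Q p) \<bullet> (z\<^sub>n - z\<^sub>n\<^sub>-\<^sub>1) + \<gamma> \<mu> \<parallel>z\<^sub>n - y\<^sub>n\<^sub>-\<^sub>1\<parallel>\<^sup>2\<close> is nonnegative and decreases by a fixed multiple of
  \<open>\<parallel>z\<^sub>n - z\<^sub>n\<^sub>-\<^sub>1\<parallel>\<^sup>2 + \<parallel>z\<^sub>n\<^sub>+\<^sub>1 - y\<^sub>n\<parallel>\<^sup>2\<close> as soon as \<open>\<gamma> \<mu> < sqrt 2 - 1\<close>. So these increments vanish, \<open>\<parallel>z\<^sub>n - p\<parallel>\<close>
  converges, weak cluster points are zeros of \<open>M + Q\<close>, and Opial's argument concludes.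
\<close>

section \<open>Minimization and duality in complete subspaces\<close>

text \<open>Along a minimizing sequence of \<open>t + z \<bullet> z / 2\<close> the first components
  are Cauchy by strong convexity, and the real coordinate then converges as a difference. The
  conclusion is the first-order optimality condition. Applied to a graph it yields Riesz
  representation, applied to an epigraph Minty's theorem.\<close>

lemma quadratic_minimizer:
  fixes C :: "('a::real_inner \<times> real) set"
  assumes S: "complete S" and C: "closed C" "convex C" "C \<noteq> {}" "C \<subseteq> S \<times> UNIV"
    and bdd: "\<And>z t. (z, t) \<in> C \<Longrightarrow> c \<le> t + z \<bullet> z / 2"
  obtains z t where "(z, t) \<in> C" "\<And>z' t'. (z', t') \<in> C \<Longrightarrow> t \<le> t' + z \<bullet> (z' - z)"
proof -
  define \<phi> where "\<phi> = (\<lambda>p::'a \<times> real. snd p + fst p \<bullet> fst p / 2)"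
  define I where "I = Inf (\<phi> ` C)"
  have bb: "bdd_below (\<phi> ` C)"
    using bdd by (intro bdd_belowI2[of _ c]) (auto simp: \<phi>_def)
  have I_le: "I \<le> \<phi> p" if "p \<in> C" for p
    unfolding I_def using bb that by (intro cInf_lower) auto
  have "\<exists>p\<in>C. \<phi> p < I + 1 / real (Suc n)" for n
  proof -
    have "Inf (\<phi> ` C) < I + 1 / real (Suc n)" unfolding I_def by simp
    then show ?thesis using cInf_less_iff[of "\<phi> ` C"] bb C(3) by auto
  qed
  then obtain p where p: "\<And>n. p n \<in> C" "\<And>n. \<phi> (p n) < I + 1 / real (Suc n)" by metis
  have phi_lim: "(\<lambda>n. \<phi> (p n)) \<longlonglongrightarrow> I"
  proof (rule tendsto_sandwich[of "\<lambda>_. I" _ _ "\<lambda>n. I + 1 / real (Suc n)"])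
    show "(\<lambda>n. I + 1 / real (Suc n)) \<longlonglongrightarrow> I"
      using tendsto_add[OF tendsto_const LIMSEQ_Suc[OF lim_1_over_n], of I] by simp
  qed (use p I_le in \<open>auto intro!: always_eventually less_imp_le simp del: of_nat_Suc\<close>)
  \<comment> \<open>At the midpoint of \<open>q\<close> and \<open>r\<close> the quadratic part
    falls below the mean of its values by an eighth of the squared distance, while \<open>I\<close>
    still bounds \<open>\<phi>\<close> from below.\<close>
  have para: "(norm (fst q - fst r))\<^sup>2 \<le> 4 * (\<phi> q + \<phi> r - 2 * I)" if "q \<in> C" "r \<in> C" for q r
  proof -
    have "(1/2) *\<^sub>R q + (1/2) *\<^sub>R r \<in> C" using C(2) that by (intro convexD) auto
    then have "I \<le> \<phi> ((1/2) *\<^sub>R q + (1/2) *\<^sub>R r)" by (rule I_le)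
    then show ?thesis
      by (simp add: \<phi>_def power2_norm_eq_inner algebra_simps inner_commute add_divide_distrib)
  qed
  have "Cauchy (\<lambda>n. fst (p n))"
  proof (rule metric_CauchyI)
    fix e :: real assume e: "e > 0"
    obtain N where N: "1 / real (Suc N) < e\<^sup>2 / 8"
      using e by (meson nat_approx_posE zero_less_divide_iff zero_less_numeral zero_less_power)
    have "dist (fst (p k)) (fst (p n)) < e" if "k \<ge> N" "n \<ge> N" for k n
    proof -
      \<comment> \<open>The two excesses over \<open>I\<close> enter \<open>para\<close> with the
        factor 4, so \<open>e\<^sup>2 / 8\<close> for each adds up to
        \<open>e\<^sup>2\<close>.\<close>
      have *: "\<phi> (p j) < I + e\<^sup>2 / 8" if "j \<ge> N" for j
      proof -
        have "1 / real (Suc j) \<le> 1 / real (Suc N)" using that by (intro divide_left_mono) auto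
        then show ?thesis using p(2)[of j] N by linarith
      qed
      have "(norm (fst (p k) - fst (p n)))\<^sup>2 < e\<^sup>2"
        by (rule le_less_trans[OF para[OF p(1) p(1)]])
          (use *[OF that(1)] *[OF that(2)] in \<open>simp add: field_simps\<close>)
      then show ?thesis using e by (simp add: dist_norm power2_less_imp_less)
    qed
    then show "\<exists>M. \<forall>m\<ge>M. \<forall>n\<ge>M. dist (fst (p m)) (fst (p n)) < e" by blast
  qed
  moreover have "\<forall>n. fst (p n) \<in> S" using p(1) C(4) by (metis SigmaE fst_conv subsetD)
  ultimately obtain z where z: "(\<lambda>n. fst (p n)) \<longlonglongrightarrow> z" using S by (auto simp: complete_def)
  have sl: "(\<lambda>n. snd (p n)) \<longlonglongrightarrow> I - z \<bullet> z / 2"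
  proof -
    have "(\<lambda>n. \<phi> (p n) - fst (p n) \<bullet> fst (p n) / 2) \<longlonglongrightarrow> I - z \<bullet> z / 2"
      by (intro tendsto_intros phi_lim z) auto
    then show ?thesis by (simp add: \<phi>_def)
  qed
  define t where "t = I - z \<bullet> z / 2"
  have zt: "(z, t) \<in> C"
    using closed_sequentially[OF C(1) p(1)] tendsto_Pair[OF z sl] by (simp add: t_def)
  moreover have "t \<le> t' + z \<bullet> (z' - z)" if zt': "(z', t') \<in> C" for z' t'
  proof (rule field_le_epsilon)
    fix e :: real assume e: "e > 0"
    define d where "d = (z' - z) \<bullet> (z' - z)"
    have d0: "d \<ge> 0" by (simp add: d_def)
    \<comment> \<open>After division by \<open>s\<close>, moving the fraction \<open>s\<close>
      toward \<open>(z', t')\<close> costs the second-order error \<open>s * d / 2\<close>. This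
      choice keeps it below \<open>e\<close>; \<open>d + 1\<close> avoids division by zero.\<close>
    define s where "s = min 1 (e / (d + 1))"
    have s: "0 < s" "s \<le> 1" using e d0 by (auto simp: s_def)
    have sd: "s * d / 2 \<le> e"
    proof -
      have "s * d \<le> e / (d + 1) * d" using d0 by (intro mult_right_mono) (auto simp: s_def)
      also have "\<dots> \<le> e" using d0 e by (simp add: divide_simps)
      finally show ?thesis using e by linarith
    qed
    have "(1 - s) *\<^sub>R (z, t) + s *\<^sub>R (z', t') \<in> C"
      using C(2) zt zt' s by (intro convexD) auto
    then have "t + z \<bullet> z / 2 \<le> \<phi> ((1 - s) *\<^sub>R (z, t) + s *\<^sub>R (z', t'))"
      using I_le by (simp add: t_def)
    also have "\<dots> = t + z \<bullet> z / 2 + s * (t' + z \<bullet> (z' - z) - t + s * d / 2)"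
      by (simp add: \<phi>_def d_def algebra_simps inner_commute add_divide_distrib diff_divide_distrib)
    finally have "0 \<le> t' + z \<bullet> (z' - z) - t + s * d / 2"
      using s(1) by (simp add: zero_le_mult_iff)
    then show "t \<le> t' + z \<bullet> (z' - z) + e" using sd by linarith
  qed
  ultimately show ?thesis using that by blast
qed

text \<open>Minimize \<open>f x + x \<bullet> x / 2\<close> by applying
  \<open>quadratic_minimizer\<close> to the graph of \<open>f\<close>, which is closed by
  boundedness and convex by linearity. Optimality at the minimizer \<open>z\<close> in the
  directions \<open>x\<close> and \<open>- x\<close> gives
  \<open>f x = - z \<bullet> x\<close>.\<close>

lemma riesz_representation:
  fixes f :: "'a::real_inner \<Rightarrow> real"
  assumes S: "subspace S" "complete S"
    and add: "\<And>x y. x \<in> S \<Longrightarrow> y \<in> S \<Longrightarrow> f (x + y) = f x + f y"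
    and scale: "\<And>c x. x \<in> S \<Longrightarrow> f (c *\<^sub>R x) = c * f x"
    and bdd: "\<And>x. x \<in> S \<Longrightarrow> \<bar>f x\<bar> \<le> K * norm x"
  obtains l where "l \<in> S" "\<And>x. x \<in> S \<Longrightarrow> f x = l \<bullet> x"
proof -
  define C where "C = (\<lambda>x. (x, f x)) ` S"
  have diff: "f x - f y = f (x - y)" if "x \<in> S" "y \<in> S" for x y
    using add[of "x - y" y] that S(1) by (simp add: subspace_diff)
  have "closed C"
    unfolding closed_sequential_limits
  proof (intro allI impI, elim conjE)
    fix p l assume p: "\<forall>n. p n \<in> C" and lim: "p \<longlonglongrightarrow> l"
    have pS: "fst (p n) \<in> S" "snd (p n) = f (fst (p n))" for n
    proof -
      have "p n \<in> C" using p by blast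
      then show "fst (p n) \<in> S" "snd (p n) = f (fst (p n))" by (auto simp: C_def)
    qed
    have 1: "(\<lambda>n. fst (p n)) \<longlonglongrightarrow> fst l" using lim by (rule tendsto_fst)
    have lS: "fst l \<in> S"
      using closed_sequentially[OF complete_imp_closed[OF S(2)] pS(1) 1] .
    have "(\<lambda>n. f (fst (p n)) - f (fst l)) \<longlonglongrightarrow> 0"
    proof (rule Lim_null_comparison)
      show "\<forall>\<^sub>F n in sequentially. norm (f (fst (p n)) - f (fst l)) \<le> K * norm (fst (p n) - fst l)"
        using bdd pS(1) lS S(1) by (simp add: diff subspace_diff)
      have "(\<lambda>n. K * norm (fst (p n) - fst l)) \<longlonglongrightarrow> K * norm (fst l - fst l)"
        by (intro tendsto_intros 1)
      then show "(\<lambda>n. K * norm (fst (p n) - fst l)) \<longlonglongrightarrow> 0" by simp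
    qed
    then have "(\<lambda>n. snd (p n)) \<longlonglongrightarrow> f (fst l)" by (simp add: pS(2) LIM_zero_iff)
    then have "snd l = f (fst l)" using tendsto_snd[OF lim] LIMSEQ_unique by blast
    then show "l \<in> C" using lS by (auto simp: C_def image_iff intro!: bexI[of _ "fst l"] prod_eqI)
  qed
  moreover have "convex C"
  proof (rule convexI)
    fix p q and u v :: real assume "p \<in> C" "q \<in> C" and "u + v = 1"
    then obtain x y where xy: "x \<in> S" "p = (x, f x)" "y \<in> S" "q = (y, f y)" by (auto simp: C_def)
    have "u *\<^sub>R x + v *\<^sub>R y \<in> S" using xy S(1) by (simp add: subspace_add subspace_scale)
    then show "u *\<^sub>R p + v *\<^sub>R q \<in> C"
      using xy S(1) by (auto simp: C_def image_iff add scale subspace_scale)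
  qed
  moreover have "C \<noteq> {}" using S(1) subspace_0 by (auto simp: C_def)
  \<comment> \<open>The linear part is at least \<open>- (K * norm z)\<close>; complete the square
    in \<open>norm z\<close>.\<close>
  moreover have "- (K\<^sup>2 / 2) \<le> t + z \<bullet> z / 2" if "(z, t) \<in> C" for z t
  proof -
    have "- (K * norm z) \<le> t" using bdd[of z] that by (auto simp: C_def)
    moreover have "0 \<le> (K - norm z)\<^sup>2" by simp
    ultimately show ?thesis by (simp add: power2_diff power2_norm_eq_inner[symmetric])
  qed
  moreover have "C \<subseteq> S \<times> UNIV" by (auto simp: C_def)
  ultimately obtain z t where z: "(z, t) \<in> C"
    and min: "\<And>z' t'. (z', t') \<in> C \<Longrightarrow> t \<le> t' + z \<bullet> (z' - z)"
    using quadratic_minimizer[OF S(2), of C "- (K\<^sup>2 / 2)"] by metis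
  have zS: "z \<in> S" "t = f z" using z by (auto simp: C_def)
  have ge: "0 \<le> f x + z \<bullet> x" if "x \<in> S" for x
  proof -
    have "z + x \<in> S" using that zS S(1) by (simp add: subspace_add)
    then have "f z \<le> f (z + x) + z \<bullet> (z + x - z)" using min[of "z + x" "f (z + x)"] zS(2) by (simp add: C_def)
    then show ?thesis using add[OF zS(1) that] by simp
  qed
  have "f x = - z \<bullet> x" if "x \<in> S" for x
    using ge[OF that] ge[of "- x"] scale[OF that, of "-1"] that S(1) by (auto simp: subspace_neg)
  moreover have "- z \<in> S" using zS S(1) by (simp add: subspace_neg)
  ultimately show ?thesis using that by blast
qed

text \<open>\<open>adjoint\<close> is defined by choice, so its characteristic identity requires
  some adjoint to exist. Riesz representation of \<open>\<lambda>x. f x \<bullet> y\<close> supplies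
  one.\<close>

lemma adjoint_inner:
  fixes f :: "'a::{real_inner, complete_space} \<Rightarrow> 'b::real_inner"
  assumes "bounded_linear f"
  shows "f x \<bullet> y = x \<bullet> adjoint f y"
proof -
  interpret bounded_linear f by fact
  have "\<exists>l. \<forall>x. f x \<bullet> y = x \<bullet> l" for y
  proof -
    obtain l where "\<And>x. f x \<bullet> y = l \<bullet> x"
    proof (rule riesz_representation[of UNIV "\<lambda>x. f x \<bullet> y" "onorm f * norm y"])
      show "\<bar>f x \<bullet> y\<bar> \<le> onorm f * norm y * norm x" for x
        using Cauchy_Schwarz_ineq2[of "f x" y]
          mult_right_mono[OF onorm[OF assms, of x] norm_ge_zero[of y]] by (simp add: mult_ac)
    qed (auto simp: add scaleR inner_add_left complete_UNIV)
    then show ?thesis by (metis inner_commute)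
  qed
  then have "\<exists>f'. \<forall>x y. f x \<bullet> y = x \<bullet> f' y" by metis
  then show ?thesis unfolding adjoint_def by (rule someI2_ex) auto
qed

lemma norm_adjoint_le:
  fixes f :: "'a::{real_inner, complete_space} \<Rightarrow> 'b::real_inner"
  assumes "bounded_linear f"
  shows "norm (adjoint f y) \<le> onorm f * norm y"
proof (cases "adjoint f y = 0")
  case False
  let ?a = "adjoint f y"
  have "norm ?a * norm ?a = f ?a \<bullet> y"
    by (simp add: adjoint_inner[OF assms] power2_norm_eq_inner flip: power2_eq_square)
  also have "\<dots> \<le> norm (f ?a) * norm y" by (rule norm_cauchy_schwarz)
  also have "\<dots> \<le> onorm f * norm ?a * norm y"
    using onorm[OF assms] by (intro mult_right_mono) auto
  finally have "norm ?a * norm ?a \<le> norm ?a * (onorm f * norm y)" by (simp add: mult_ac)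
  then show ?thesis using False by simp
qed (simp add: onorm_pos_le assms)

lemma adjoint_diff:
  fixes f :: "'a::{real_inner, complete_space} \<Rightarrow> 'b::real_inner"
  assumes "bounded_linear f"
  shows "adjoint f (y - z) = adjoint f y - adjoint f z"
proof -
  have "x \<bullet> (adjoint f (y - z) - (adjoint f y - adjoint f z)) = 0" for x
    by (simp add: inner_diff_right flip: adjoint_inner[OF assms])
  then show ?thesis by (metis inner_eq_zero_iff right_minus_eq)
qed

section \<open>Maximally monotone operators and their resolvents\<close>

lemma complete_Times:
  fixes S :: "'a::metric_space set" and T :: "'b::metric_space set"
  assumes "complete S" "complete T"
  shows "complete (S \<times> T)"
  unfolding complete_def
proof (intro allI impI, elim conjE)
  fix f :: "nat \<Rightarrow> 'a \<times> 'b" assume f: "\<forall>n. f n \<in> S \<times> T" "Cauchy f"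
  have "fst (f n) \<in> S" "snd (f n) \<in> T" for n using f(1) by (metis mem_Times_iff)+
  then obtain l k where "l \<in> S" "(\<lambda>n. fst (f n)) \<longlonglongrightarrow> l" "k \<in> T" "(\<lambda>n. snd (f n)) \<longlonglongrightarrow> k"
    using assms Cauchy_fst[OF f(2)] Cauchy_snd[OF f(2)] unfolding complete_def by metis
  then show "\<exists>l\<in>S \<times> T. f \<longlonglongrightarrow> l" using tendsto_Pair[of "\<lambda>n. fst (f n)" l sequentially] by force
qed

lemma monotone_opD:
  assumes "monotone_op A" "u \<in> A x" "v \<in> A y"
  shows "0 \<le> (x - y) \<bullet> (u - v)"
  using assms by (auto simp: monotone_op_def gra_op_def)

text \<open>
  \<open>E\<close> below is the epigraph of the Fitzpatrick function \<open>F\<close> of the relation \<open>R\<close>. Maximality gives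
  \<open>F (x, u) \<ge> x \<bullet> u\<close>, hence \<open>F (x, u) + (\<parallel>x\<parallel>\<^sup>2 + \<parallel>u\<parallel>\<^sup>2) / 2 \<ge> 0\<close>, and the minimizer \<open>(x, u)\<close> of this strongly
  convex function satisfies \<open>(- u, - x) \<in> R\<close> and \<open>x + u = 0\<close>.
\<close>

lemma minty_at_zero:
  fixes S :: "'a::real_inner set" and R :: "('a \<times> 'a) set"
  assumes S: "subspace S" "complete S" and R: "R \<subseteq> S \<times> S"
    and mono: "\<And>a b c d. (a, b) \<in> R \<Longrightarrow> (c, d) \<in> R \<Longrightarrow> 0 \<le> (a - c) \<bullet> (b - d)"
    and max: "\<And>x u. x \<in> S \<Longrightarrow> u \<in> S \<Longrightarrow> (\<And>a b. (a, b) \<in> R \<Longrightarrow> 0 \<le> (x - a) \<bullet> (u - b)) \<Longrightarrow> (x, u) \<in> R"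
  obtains p where "(p, - p) \<in> R"
proof -
  \<comment> \<open>\<open>h p q\<close> is affine in \<open>p\<close>, and its supremum over
    \<open>q \<in> R\<close> is the Fitzpatrick function; \<open>E\<close> imposes one closed
    half-space for each \<open>q\<close>.\<close>
  define h where "h = (\<lambda>p q::'a \<times> 'a. fst p \<bullet> snd q + fst q \<bullet> snd p - fst q \<bullet> snd q)"
  define E where "E = (S \<times> S) \<times> (UNIV :: real set) \<inter> (\<Inter>q\<in>R. {p. h (fst p) q \<le> snd p})"
  have S2: "complete (S \<times> S)" using S(2) S(2) by (rule complete_Times)
  have "closed E"
    unfolding E_def h_def
    by (intro closed_Int closed_INT closed_Times ballI closed_UNIV complete_imp_closed S(2)
        closed_Collect_le continuous_intros)
  moreover have "convex E"
  proof -
    have "convex {p. h (fst p) q \<le> snd p}" for q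
    proof (rule convexI)
      fix p r :: "('a \<times> 'a) \<times> real" and s t :: real
      assume pr: "p \<in> {p. h (fst p) q \<le> snd p}" "r \<in> {p. h (fst p) q \<le> snd p}"
        and st: "0 \<le> s" "0 \<le> t" "s + t = 1"
      have "h (fst (s *\<^sub>R p + t *\<^sub>R r)) q = s * h (fst p) q + t * h (fst r) q
          + (s + t - 1) * (fst q \<bullet> snd q)"
        by (simp add: h_def algebra_simps)
      also have "\<dots> \<le> s * snd p + t * snd r"
        using pr st by (intro order.trans[OF eq_refl add_mono[OF mult_left_mono mult_left_mono]]) auto
      finally show "s *\<^sub>R p + t *\<^sub>R r \<in> {p. h (fst p) q \<le> snd p}" by simp
    qed
    then show ?thesis unfolding E_def
      by (intro convex_Int convex_INT convex_Times subspace_imp_convex[OF S(1)] convex_UNIV)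
  qed
  moreover have inE: "(q, fst q \<bullet> snd q) \<in> E" if "q \<in> R" for q
    using mono[of "fst q" "snd q"] that R by (force simp: E_def h_def algebra_simps inner_commute)
  moreover have R_ne: "R \<noteq> {}" using max[of 0 0] S(1) subspace_0 by auto
  have "E \<noteq> {}" using R_ne inE by blast
  moreover have E_ge: "fst z \<bullet> snd z \<le> t" if "(z, t) \<in> E" for z t
  proof -
    have z: "fst z \<in> S" "snd z \<in> S" using that by (auto simp: E_def)
    \<comment> \<open>If \<open>z \<in> R\<close>, take \<open>z\<close> itself; otherwise
      maximality yields a pair of \<open>R\<close> to which \<open>z\<close> is not monotonically
      related.\<close>
    obtain a b where ab: "(a, b) \<in> R" "(fst z - a) \<bullet> (snd z - b) \<le> 0"
    proof (cases "z \<in> R")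
      case True then show ?thesis using that[of "fst z" "snd z"] by simp
    next
      case False then show ?thesis using max[OF z] that by (metis linorder_le_cases prod.collapse)
    qed
    have "h z (a, b) \<le> t" using that ab(1) by (auto simp: E_def)
    then show ?thesis using ab(2) by (simp add: h_def algebra_simps inner_commute)
  qed
  moreover have E_pos: "0 \<le> t + z \<bullet> z / 2" if "(z, t) \<in> E" for z t
  proof -
    have "0 \<le> (fst z + snd z) \<bullet> (fst z + snd z)" by simp
    then show ?thesis using E_ge[OF that]
      by (simp add: inner_prod_def algebra_simps inner_commute add_divide_distrib)
  qed
  moreover have "E \<subseteq> (S \<times> S) \<times> UNIV" by (auto simp: E_def)
  ultimately obtain z t where zt: "(z, t) \<in> E"
    and min: "\<And>z' t'. (z', t') \<in> E \<Longrightarrow> t \<le> t' + z \<bullet> (z' - z)"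
    using quadratic_minimizer[OF S2, of E 0] by metis
  define x u where "x = fst z" and "u = snd z"
  have xu: "x \<in> S" "u \<in> S" using zt by (auto simp: E_def x_def u_def)
  \<comment> \<open>Optimality tested at the point of \<open>E\<close> above \<open>(a, b)\<close>,
    together with \<open>x \<bullet> u \<le> t\<close>. It makes \<open>(- u, - x)\<close>
    monotonically related to \<open>R\<close> with a margin, and testing this pair against itself
    forces the margin to vanish.\<close>
  have key: "(x + u) \<bullet> (x + u) \<le> (- u - a) \<bullet> (- x - b)" if "(a, b) \<in> R" for a b
  proof -
    have "t \<le> a \<bullet> b + z \<bullet> ((a, b) - z)" using min[OF inE[OF that]] by simp
    then show ?thesis using E_ge[OF zt]
      by (simp add: x_def u_def inner_prod_def algebra_simps inner_commute)
  qed
  have *: "(- u, - x) \<in> R"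
    using xu S(1) key by (intro max) (auto simp: subspace_neg intro: order_trans[OF inner_ge_zero])
  have "(x + u) \<bullet> (x + u) \<le> 0" using key[OF *] by simp
  then have "x + u = 0" by (metis inner_eq_zero_iff inner_ge_zero order_antisym)
  then have "x = - u" by (simp add: eq_neg_iff_add_eq_0)
  then show ?thesis using that[of "- u"] * by simp
qed

text \<open>Otherwise adding the single pair \<open>(x, u)\<close> to the graph would give a proper
  monotone extension.\<close>

lemma maximally_monotone_onD:
  assumes "maximally_monotone_on S A" and "x \<in> S" "u \<in> S"
    and rel: "\<And>a b. b \<in> A a \<Longrightarrow> 0 \<le> (x - a) \<bullet> (u - b)"
  shows "u \<in> A x"
proof (rule ccontr)
  assume u: "u \<notin> A x"
  define C where "C = A(x := insert u (A x))"
  have A: "gra_op A \<subseteq> S \<times> S" "monotone_op A"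
    and max: "\<And>C. gra_op C \<subseteq> S \<times> S \<Longrightarrow> monotone_op C \<Longrightarrow> \<not> gra_op A \<subset> gra_op C"
    using assms(1) by (auto simp: maximally_monotone_on_def)
  have gra: "gra_op C = insert (x, u) (gra_op A)"
    by (auto simp: C_def gra_op_def split: if_splits)
  have "0 \<le> (a - x) \<bullet> (b - u)" if "b \<in> A a" for a b
    using rel[OF that] by (simp add: algebra_simps inner_commute)
  then have "monotone_op C"
    using A(2) rel unfolding monotone_op_def gra by (auto simp: gra_op_def)
  moreover have "gra_op C \<subseteq> S \<times> S" using A(1) assms(2,3) by (simp add: gra)
  moreover have "gra_op A \<subset> gra_op C" using u by (auto simp: gra) (auto simp: gra_op_def)
  ultimately show False using max by blast
qed

lemma maximally_monotone_on_inv_op: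
  assumes "maximally_monotone_on S A"
  shows "maximally_monotone_on S (inv_op A)"
proof -
  have gra: "gra_op (inv_op C) = prod.swap ` gra_op C" for C :: "'a \<Rightarrow> 'a set"
    by (force simp: gra_op_def inv_op_def)
  have mono: "monotone_op (inv_op C)" if "monotone_op C" for C :: "'a \<Rightarrow> 'a set"
    using that unfolding monotone_op_def gra by (auto simp: inner_commute)
  have swap: "prod.swap ` X \<subseteq> S \<times> S" if "X \<subseteq> S \<times> S" for X :: "('a \<times> 'a) set"
    using that by auto
  show ?thesis
    unfolding maximally_monotone_on_def
  proof (intro conjI notI)
    show "gra_op (inv_op A) \<subseteq> S \<times> S" "monotone_op (inv_op A)"
      using assms by (auto simp: maximally_monotone_on_def gra[of A] intro!: mono swap)
    assume "\<exists>C. gra_op C \<subseteq> S \<times> S \<and> monotone_op C \<and> gra_op (inv_op A) \<subset> gra_op C"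
    then obtain C where C: "gra_op C \<subseteq> S \<times> S" "monotone_op C" "gra_op (inv_op A) \<subset> gra_op C" by blast
    have "gra_op A \<subset> gra_op (inv_op C)"
      using C(3) unfolding gra by (auto simp: psubset_eq image_iff) force+
    then show False
      using assms C(1,2) mono[OF C(2)] swap[OF C(1)] unfolding maximally_monotone_on_def gra[symmetric]
      by blast
  qed
qed

text \<open>Reduces to \<open>minty_at_zero\<close> for the relation \<open>R\<close> of
  \<open>\<gamma> A - w\<close>, which inherits monotonicity and maximality from \<open>A\<close>: a
  pair \<open>(p, - p)\<close> in \<open>R\<close> is the claim.\<close>

lemma minty:
  assumes S: "subspace S" "complete S" and A: "maximally_monotone_on S A"
    and "0 < \<gamma>" "w \<in> S"
  obtains p where "p \<in> S" "(1 / \<gamma>) *\<^sub>R (w - p) \<in> A p"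
proof -
  define R where "R = {(p, q). (1 / \<gamma>) *\<^sub>R (q + w) \<in> A p}"
  have gra: "gra_op A \<subseteq> S \<times> S" and mono: "monotone_op A"
    using A by (auto simp: maximally_monotone_on_def)
  have AS: "a \<in> S" "b \<in> S" if "b \<in> A a" for a b using gra that by (auto simp: gra_op_def)
  have RS: "R \<subseteq> S \<times> S"
  proof clarify
    fix p q assume "(p, q) \<in> R"
    then have "p \<in> S" and "(1 / \<gamma>) *\<^sub>R (q + w) \<in> S" using AS by (auto simp: R_def)
    then have "\<gamma> *\<^sub>R ((1 / \<gamma>) *\<^sub>R (q + w)) - w \<in> S"
      using subspace_diff[OF S(1) subspace_scale[OF S(1)] \<open>w \<in> S\<close>] by blast
    moreover have "\<gamma> *\<^sub>R ((1 / \<gamma>) *\<^sub>R (q + w)) - w = q" using \<open>0 < \<gamma>\<close> by simp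
    ultimately show "p \<in> S \<and> q \<in> S" using \<open>p \<in> S\<close> by metis
  qed
  obtain p where "(p, - p) \<in> R"
  proof (rule minty_at_zero[OF S RS])
    show "0 \<le> (a - c) \<bullet> (b - d)" if "(a, b) \<in> R" "(c, d) \<in> R" for a b c d
    proof -
      have "0 \<le> (a - c) \<bullet> ((1 / \<gamma>) *\<^sub>R (b + w) - (1 / \<gamma>) *\<^sub>R (d + w))"
        using that mono by (auto simp: R_def monotone_op_def gra_op_def)
      also have "\<dots> = (1 / \<gamma>) * ((a - c) \<bullet> (b - d))" by (simp add: algebra_simps)
      finally show ?thesis using \<open>0 < \<gamma>\<close> by (simp add: zero_le_divide_iff)
    qed
    show "(x, u) \<in> R" if xu: "x \<in> S" "u \<in> S"
      and rel: "\<And>a b. (a, b) \<in> R \<Longrightarrow> 0 \<le> (x - a) \<bullet> (u - b)" for x u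
    proof -
      have "(1 / \<gamma>) *\<^sub>R (u + w) \<in> A x"
      proof (rule maximally_monotone_onD[OF A xu(1)])
        show "(1 / \<gamma>) *\<^sub>R (u + w) \<in> S" using xu \<open>w \<in> S\<close> S(1) by (simp add: subspace_add subspace_scale)
        fix a b assume b: "b \<in> A a"
        have "(a, \<gamma> *\<^sub>R b - w) \<in> R" using b \<open>0 < \<gamma>\<close> by (simp add: R_def)
        then have "0 \<le> (1 / \<gamma>) * ((x - a) \<bullet> (u - (\<gamma> *\<^sub>R b - w)))" using rel \<open>0 < \<gamma>\<close> by simp
        also have "\<dots> = (x - a) \<bullet> ((1 / \<gamma>) *\<^sub>R (u + w) - b)"
          using \<open>0 < \<gamma>\<close> by (simp add: field_simps inner_add_right inner_diff_right)
        finally show "0 \<le> (x - a) \<bullet> ((1 / \<gamma>) *\<^sub>R (u + w) - b)" .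
      qed
      then show ?thesis by (simp add: R_def)
    qed
  qed blast
  then show ?thesis using that AS(1) by (auto simp: R_def)
qed

text \<open>Minty's theorem gives a solution and monotonicity makes it unique, so
  \<open>the_elem\<close> in \<open>resolvent\<close> is meaningful. The iteration uses resolvents
  only through these two facts.\<close>

lemma resolvent_scale_op:
  assumes S: "subspace S" "complete S" and A: "maximally_monotone_on S A"
    and \<gamma>: "0 < \<gamma>" and w: "w \<in> S"
  shows "resolvent (scale_op \<gamma> A) w \<in> S"
    and "(1 / \<gamma>) *\<^sub>R (w - resolvent (scale_op \<gamma> A) w) \<in> A (resolvent (scale_op \<gamma> A) w)"
proof -
  have iff: "w \<in> {p} + scale_op \<gamma> A p \<longleftrightarrow> (1 / \<gamma>) *\<^sub>R (w - p) \<in> A p" for p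
    using \<gamma> by (force simp: set_plus_def scale_op_def image_iff algebra_simps)
  obtain p where p: "p \<in> S" "(1 / \<gamma>) *\<^sub>R (w - p) \<in> A p" using minty[OF S A \<gamma> w] .
  have "q = p" if q: "(1 / \<gamma>) *\<^sub>R (w - q) \<in> A q" for q
  proof -
    have "0 \<le> (q - p) \<bullet> ((1 / \<gamma>) *\<^sub>R (w - q) - (1 / \<gamma>) *\<^sub>R (w - p))"
      using A p(2) q by (auto simp: maximally_monotone_on_def monotone_op_def gra_op_def)
    also have "\<dots> = - ((1 / \<gamma>) * ((q - p) \<bullet> (q - p)))" by (simp add: algebra_simps)
    finally have "(q - p) \<bullet> (q - p) \<le> 0" using \<gamma> by (simp add: divide_le_0_iff)
    then show ?thesis by (metis inner_eq_zero_iff inner_ge_zero order_antisym right_minus_eq)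
  qed
  then have "inv_op (\<lambda>x. {x} + scale_op \<gamma> A x) w = {p}"
    unfolding inv_op_def iff using p(2) by blast
  then have "resolvent (scale_op \<gamma> A) w = p" by (simp add: resolvent_def value_op_def)
  then show "resolvent (scale_op \<gamma> A) w \<in> S"
    "(1 / \<gamma>) *\<^sub>R (w - resolvent (scale_op \<gamma> A) w) \<in> A (resolvent (scale_op \<gamma> A) w)"
    using p by (simp_all only:)
qed

section \<open>Weak cluster points\<close>

text \<open>
  Cluster points are taken along filters: Tychonoff's theorem in the space of functionals
  applies without separability and spares a diagonal extraction of subsequences.
\<close>

lemma weak_cluster_point:
  fixes z :: "'b \<Rightarrow> 'a::real_inner"
  assumes S: "subspace S" "complete S" and z: "\<And>n. norm (z n) \<le> R" and F0: "F0 \<noteq> bot"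
  obtains F l where "F \<le> F0" "F \<noteq> bot" "l \<in> S" "\<forall>w\<in>S. ((\<lambda>n. z n \<bullet> w) \<longlongrightarrow> l \<bullet> w) F"
proof -
  define K :: "('a \<Rightarrow> real) set" where "K = (\<Pi>\<^sub>E w\<in>UNIV. {- (R * norm w)..R * norm w})"
  define g where "g = (\<lambda>n w. z n \<bullet> w)"
  have "compact K"
    using compactin_PiE[of "\<lambda>_::'a. euclidean :: real topology" UNIV "\<lambda>w. {- (R * norm w)..R * norm w}"]
    by (simp add: K_def euclidean_product_topology)
  moreover have "filtermap g F0 \<noteq> bot" using F0 by (simp add: filtermap_bot_iff)
  moreover have "g n \<in> K" for n
  proof -
    have "\<bar>z n \<bullet> w\<bar> \<le> R * norm w" for w
      using Cauchy_Schwarz_ineq2[of "z n" w] mult_right_mono[OF z norm_ge_zero[of w], of n] by linarith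
    then show ?thesis by (auto simp: g_def K_def abs_le_iff minus_le_iff)
  qed
  then have "\<forall>\<^sub>F h in filtermap g F0. h \<in> K" by (simp add: eventually_filtermap)
  ultimately obtain \<phi> where phi: "\<phi> \<in> K" "inf (nhds \<phi>) (filtermap g F0) \<noteq> bot"
    unfolding compact_filter by blast
  \<comment> \<open>Pulling the neighbourhoods of the cluster point \<open>\<phi>\<close> back along
    \<open>g\<close> gives a filter on indices, finer than \<open>F0\<close>, along which
    \<open>g\<close> converges to \<open>\<phi>\<close>.\<close>
  define F where "F = inf F0 (filtercomap g (nhds \<phi>))"
  have F: "F \<noteq> bot"
  proof
    assume "F = bot"
    then obtain P Q where P: "eventually P F0" and Q: "eventually Q (nhds \<phi>)" and PQ: "\<And>n. P n \<Longrightarrow> Q (g n) \<Longrightarrow> False"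
      unfolding F_def trivial_limit_def eventually_inf eventually_filtercomap by metis
    have "eventually (\<lambda>h. \<not> Q h) (filtermap g F0)"
      unfolding eventually_filtermap using P by (rule eventually_mono) (use PQ in blast)
    then have "eventually (\<lambda>h. False) (inf (nhds \<phi>) (filtermap g F0))"
      unfolding eventually_inf using Q by blast
    then show False using phi(2) by (simp add: trivial_limit_def)
  qed
  have lim: "((\<lambda>n. z n \<bullet> w) \<longlongrightarrow> \<phi> w) F" for w
  proof -
    have "filterlim g (nhds \<phi>) F"
      unfolding F_def filterlim_iff_le_filtercomap by simp
    then have "((\<lambda>n. g n w) \<longlongrightarrow> \<phi> w) F"
      by (rule continuous_on_tendsto_compose[OF continuous_on_product_coordinates[of w]]) simp_all
    then show ?thesis by (simp add: g_def)
  qed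
  \<comment> \<open>As a pointwise limit, \<open>\<phi>\<close> inherits linearity and the bound
    \<open>R\<close>, so it is represented on \<open>S\<close> by an element of
    \<open>S\<close>.\<close>
  obtain l where l: "l \<in> S" "\<And>w. w \<in> S \<Longrightarrow> \<phi> w = l \<bullet> w"
  proof (rule riesz_representation[OF S, of \<phi> R])
    show "\<phi> (x + y) = \<phi> x + \<phi> y" for x y
      using tendsto_unique[OF F lim] tendsto_add[OF lim lim] by (simp add: inner_add_right)
    show "\<phi> (c *\<^sub>R x) = c * \<phi> x" for c x
      using tendsto_unique[OF F lim] tendsto_mult_left[OF lim] by simp
    show "\<bar>\<phi> x\<bar> \<le> R * norm x" for x
      using phi(1) by (auto simp: K_def abs_le_iff minus_le_iff PiE_iff)
  qed blast
  have "\<forall>w\<in>S. ((\<lambda>n. z n \<bullet> w) \<longlongrightarrow> l \<bullet> w) F" using lim by (simp flip: l(2))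
  moreover have "F \<le> F0" by (simp add: F_def)
  ultimately show ?thesis using that F l(1) by blast
qed

text \<open>For weak cluster points \<open>l\<close> and \<open>k\<close>, expanding
  \<open>(norm (z n - k))\<^sup>2 - (norm (z n - l))\<^sup>2\<close> shows that
  \<open>z n \<bullet> (l - k)\<close> converges. Its limit is both
  \<open>l \<bullet> (l - k)\<close> and \<open>k \<bullet> (l - k)\<close>, so
  \<open>l = k\<close>; with boundedness, uniqueness of the cluster point gives convergence.\<close>

lemma opial:
  fixes z :: "nat \<Rightarrow> 'a::real_inner"
  assumes S: "subspace S" "complete S" and Z: "Z \<subseteq> S" "Z \<noteq> {}"
    and conv: "\<And>p. p \<in> Z \<Longrightarrow> convergent (\<lambda>n. norm (z n - p))"
    and cluster: "\<And>F l. F \<le> sequentially \<Longrightarrow> F \<noteq> bot \<Longrightarrow> l \<in> S \<Longrightarrow>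
      \<forall>w\<in>S. ((\<lambda>n. z n \<bullet> w) \<longlongrightarrow> l \<bullet> w) F \<Longrightarrow> l \<in> Z"
  obtains l where "l \<in> Z" "\<And>w. w \<in> S \<Longrightarrow> (\<lambda>n. z n \<bullet> w) \<longlonglongrightarrow> l \<bullet> w"
proof -
  obtain p where p: "p \<in> Z" using Z by blast
  obtain R0 where R0: "\<And>n. norm (z n - p) \<le> R0"
    using convergent_imp_Bseq[OF conv[OF p]] by (auto simp: Bseq_def)
  have bdd: "norm (z n) \<le> R0 + norm p" for n
    using R0[of n] norm_triangle_sub[of "z n" p] by linarith
  have uniq: "l = k"
    if l: "F \<le> sequentially" "F \<noteq> bot" "l \<in> S" "\<forall>w\<in>S. ((\<lambda>n. z n \<bullet> w) \<longlongrightarrow> l \<bullet> w) F"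
      and k: "F' \<le> sequentially" "F' \<noteq> bot" "k \<in> S" "\<forall>w\<in>S. ((\<lambda>n. z n \<bullet> w) \<longlongrightarrow> k \<bullet> w) F'"
    for F F' l k
  proof -
    obtain a b where a: "(\<lambda>n. norm (z n - l)) \<longlonglongrightarrow> a" and b: "(\<lambda>n. norm (z n - k)) \<longlonglongrightarrow> b"
      using conv[OF cluster[OF l]] conv[OF cluster[OF k]] by (auto simp: convergent_def)
    define c where "c = (b\<^sup>2 - a\<^sup>2 + l \<bullet> l - k \<bullet> k) / 2"
    have "(\<lambda>n. ((norm (z n - k))\<^sup>2 - (norm (z n - l))\<^sup>2 + l \<bullet> l - k \<bullet> k) / 2) \<longlonglongrightarrow> c"
      unfolding c_def by (intro tendsto_intros a b) auto
    then have c: "(\<lambda>n. z n \<bullet> (l - k)) \<longlonglongrightarrow> c"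
      by (simp add: power2_norm_eq_inner algebra_simps inner_commute diff_divide_distrib)
    have lk: "l - k \<in> S" using l(3) k(3) S(1) by (simp add: subspace_diff)
    have "l \<bullet> (l - k) = c"
      using tendsto_unique[OF l(2) bspec[OF l(4) lk] tendsto_mono[OF l(1) c]] .
    moreover have "k \<bullet> (l - k) = c"
      using tendsto_unique[OF k(2) bspec[OF k(4) lk] tendsto_mono[OF k(1) c]] .
    ultimately have "(l - k) \<bullet> (l - k) = 0" by (simp add: inner_diff_left)
    then show ?thesis by simp
  qed
  obtain F l where l: "F \<le> sequentially" "F \<noteq> bot" "l \<in> S"
    "\<forall>w\<in>S. ((\<lambda>n. z n \<bullet> w) \<longlongrightarrow> l \<bullet> w) F"
    using weak_cluster_point[where z = z, OF S bdd sequentially_bot] by metis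
  have "(\<lambda>n. z n \<bullet> w) \<longlonglongrightarrow> l \<bullet> w" if w: "w \<in> S" for w
  proof (rule ccontr)
    assume "\<not> ?thesis"
    then obtain e where e: "e > 0" "\<not> (\<forall>\<^sub>F n in sequentially. dist (z n \<bullet> w) (l \<bullet> w) < e)"
      by (auto simp: tendsto_iff)
    \<comment> \<open>The indices at which the values stay \<open>e\<close> away from
      \<open>l \<bullet> w\<close>. A cluster point along this filter would have to differ from
      \<open>l\<close>.\<close>
    define F0 where "F0 = inf sequentially (principal {n. \<not> dist (z n \<bullet> w) (l \<bullet> w) < e})"
    have "F0 \<noteq> bot"
      using e(2) by (auto simp: F0_def trivial_limit_def eventually_inf_principal)
    from weak_cluster_point[where z = z, OF S bdd this] obtain F' k where k: "F' \<le> F0" "F' \<noteq> bot" "k \<in> S"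
      "\<forall>w\<in>S. ((\<lambda>n. z n \<bullet> w) \<longlongrightarrow> k \<bullet> w) F'"
      by metis
    have "F' \<le> sequentially" using k(1) by (simp add: F0_def)
    then have "k = l" using uniq[OF _ k(2-4) l] by blast
    then have "\<forall>\<^sub>F n in F'. dist (z n \<bullet> w) (l \<bullet> w) < e" using bspec[OF k(4) w] e(1) by (auto simp: tendsto_iff)
    moreover have "\<forall>\<^sub>F n in F'. \<not> dist (z n \<bullet> w) (l \<bullet> w) < e"
      using k(1) by (rule filter_leD) (auto simp: F0_def eventually_inf_principal)
    ultimately have "\<forall>\<^sub>F n in F'. False" by eventually_elim blast
    then show False using k(2) by (simp add: trivial_limit_def)
  qed
  then show ?thesis using that cluster[OF l] by blast
qed

section \<open>The reflected forward-backward iteration\<close>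

text \<open>
  Read \<open>z\<^sub>0, z\<^sub>1, z\<^sub>2\<close> as three consecutive iterates, \<open>y, y'\<close> as the reflected points at which \<open>Q\<close> takes
  the values \<open>Q\<^sub>0, Q\<^sub>1\<close>, and \<open>U\<^sub>1, U\<^sub>2\<close> as \<open>\<gamma>\<close> times elements of \<open>M z\<^sub>1, M z\<^sub>2\<close>. The inner product with
  \<open>U + \<gamma> q\<close> in the energy is what makes the term in the old value \<open>Q\<^sub>0\<close> telescope.
\<close>

lemma reflected_step_energy:
  fixes p z\<^sub>0 z\<^sub>1 z\<^sub>2 y Q\<^sub>0 Q\<^sub>1 q :: "'a::real_inner" and \<gamma> \<mu> :: real
  defines "U\<^sub>1 \<equiv> z\<^sub>0 - z\<^sub>1 - \<gamma> *\<^sub>R Q\<^sub>0" and "U\<^sub>2 \<equiv> z\<^sub>1 - z\<^sub>2 - \<gamma> *\<^sub>R Q\<^sub>1" and "y' \<equiv> 2 *\<^sub>R z\<^sub>1 - z\<^sub>0"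
  assumes "0 \<le> \<gamma>" "0 \<le> \<mu>"
    and M: "0 \<le> (U\<^sub>2 + \<gamma> *\<^sub>R q) \<bullet> (z\<^sub>2 - p)" "0 \<le> (U\<^sub>2 - U\<^sub>1) \<bullet> (z\<^sub>2 - z\<^sub>1)"
    and Q: "0 \<le> (Q\<^sub>1 - q) \<bullet> (y' - p)" "norm (Q\<^sub>1 - Q\<^sub>0) \<le> \<mu> * norm (y' - y)"
    and \<gamma>\<mu>: "\<gamma> * \<mu> * (1 + sqrt 2) \<le> 1"
  shows "(norm (z\<^sub>2 - p))\<^sup>2 - 2 * ((U\<^sub>2 + \<gamma> *\<^sub>R q) \<bullet> (z\<^sub>2 - z\<^sub>1)) + \<gamma> * \<mu> * (norm (z\<^sub>2 - y'))\<^sup>2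
      + (1 - \<gamma> * \<mu> * (1 + sqrt 2)) * ((norm (z\<^sub>1 - z\<^sub>0))\<^sup>2 + (norm (z\<^sub>2 - y'))\<^sup>2)
    \<le> (norm (z\<^sub>1 - p))\<^sup>2 - 2 * ((U\<^sub>1 + \<gamma> *\<^sub>R q) \<bullet> (z\<^sub>1 - z\<^sub>0)) + \<gamma> * \<mu> * (norm (z\<^sub>1 - y))\<^sup>2"
proof -
  define \<alpha> \<beta> \<delta> where "\<alpha> = norm (z\<^sub>1 - z\<^sub>0)" and "\<beta> = norm (z\<^sub>1 - y)" and "\<delta> = norm (z\<^sub>2 - y')"
  define \<kappa> where "\<kappa> = \<gamma> * \<mu>"
  have k0: "0 \<le> \<kappa>" using assms by (simp add: \<kappa>_def)
  have "0 \<le> \<gamma> * ((Q\<^sub>1 - q) \<bullet> (y' - p))" using Q(1) \<open>0 \<le> \<gamma>\<close> by simp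
  \<comment> \<open>Twice the sum of three monotonicity inequalities: \<open>M\<close> at
    \<open>z\<^sub>2\<close> and \<open>p\<close>, \<open>M\<close> at \<open>z\<^sub>2\<close> and
    \<open>z\<^sub>1\<close>, and \<open>\<gamma>\<close> times that of \<open>Q\<close> at
    \<open>y'\<close> and \<open>p\<close>.\<close>
  then have 1: "(norm (z\<^sub>2 - p))\<^sup>2 - 2 * ((U\<^sub>2 + \<gamma> *\<^sub>R q) \<bullet> (z\<^sub>2 - z\<^sub>1))
      \<le> (norm (z\<^sub>1 - p))\<^sup>2 - 2 * ((U\<^sub>1 + \<gamma> *\<^sub>R q) \<bullet> (z\<^sub>1 - z\<^sub>0)) - \<alpha>\<^sup>2 - \<delta>\<^sup>2
        - 2 * \<gamma> * ((Q\<^sub>1 - Q\<^sub>0) \<bullet> (z\<^sub>2 - y'))"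
    using M unfolding U\<^sub>1_def U\<^sub>2_def y'_def \<alpha>_def \<delta>_def power2_norm_eq_inner
    by (simp add: algebra_simps inner_commute)
  have "norm (Q\<^sub>1 - Q\<^sub>0) \<le> \<mu> * (\<alpha> + \<beta>)"
  proof -
    have "y' - y = (z\<^sub>1 - z\<^sub>0) + (z\<^sub>1 - y)" by (simp add: y'_def scaleR_2)
    then have "norm (y' - y) \<le> \<alpha> + \<beta>" by (metis \<alpha>_def \<beta>_def norm_triangle_ineq)
    then show ?thesis using Q(2) \<open>0 \<le> \<mu>\<close> by (meson mult_left_mono order_trans)
  qed
  then have "- ((Q\<^sub>1 - Q\<^sub>0) \<bullet> (z\<^sub>2 - y')) \<le> \<mu> * (\<alpha> + \<beta>) * \<delta>"
    using Cauchy_Schwarz_ineq2[of "Q\<^sub>1 - Q\<^sub>0" "z\<^sub>2 - y'"] mult_right_mono[of "norm (Q\<^sub>1 - Q\<^sub>0)" "\<mu> * (\<alpha> + \<beta>)" \<delta>]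
    by (simp add: \<delta>_def)
  then have "\<gamma> * - ((Q\<^sub>1 - Q\<^sub>0) \<bullet> (z\<^sub>2 - y')) \<le> \<gamma> * (\<mu> * (\<alpha> + \<beta>) * \<delta>)"
    using \<open>0 \<le> \<gamma>\<close> by (rule mult_left_mono)
  then have 2: "- 2 * \<gamma> * ((Q\<^sub>1 - Q\<^sub>0) \<bullet> (z\<^sub>2 - y')) \<le> \<kappa> * (2 * \<alpha> * \<delta> + 2 * \<beta> * \<delta>)"
    by (simp add: \<kappa>_def algebra_simps)
  \<comment> \<open>This weight in Young's inequality makes the coefficient \<open>1 - \<kappa> sqrt 2\<close> left for \<open>\<delta>\<^sup>2\<close> dominate the
    \<open>\<kappa>\<close> that is carried over to the next step exactly when \<open>\<kappa> \<le> sqrt 2 - 1\<close>.\<close>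
  have "2 * \<alpha> * \<delta> \<le> (1 + sqrt 2) * \<alpha>\<^sup>2 + (sqrt 2 - 1) * \<delta>\<^sup>2"
  proof -
    have "0 \<le> (sqrt 2 - 1) * ((1 + sqrt 2) * \<alpha> - \<delta>)\<^sup>2" by simp
    also have "\<dots> = ((sqrt 2)\<^sup>2 - 1) * ((1 + sqrt 2) * \<alpha>\<^sup>2 - 2 * \<alpha> * \<delta>) + (sqrt 2 - 1) * \<delta>\<^sup>2"
      by (simp add: power2_eq_square algebra_simps)
    finally show ?thesis by simp
  qed
  moreover have "2 * \<beta> * \<delta> \<le> \<beta>\<^sup>2 + \<delta>\<^sup>2" using sum_squares_bound[of \<beta> \<delta>] .
  ultimately have "\<kappa> * (2 * \<alpha> * \<delta> + 2 * \<beta> * \<delta>)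
      \<le> \<kappa> * (((1 + sqrt 2) * \<alpha>\<^sup>2 + (sqrt 2 - 1) * \<delta>\<^sup>2) + (\<beta>\<^sup>2 + \<delta>\<^sup>2))"
    using k0 by (intro mult_left_mono) auto
  then have 3: "\<kappa> * (2 * \<alpha> * \<delta> + 2 * \<beta> * \<delta>) \<le> \<kappa> * (1 + sqrt 2) * \<alpha>\<^sup>2 + \<kappa> * sqrt 2 * \<delta>\<^sup>2 + \<kappa> * \<beta>\<^sup>2"
    by (simp add: algebra_simps)
  show ?thesis
    using 1 2 3 unfolding \<alpha>_def[symmetric] \<beta>_def[symmetric] \<delta>_def[symmetric] \<kappa>_def[symmetric]
    by (simp add: algebra_simps)
qed

text \<open>Expanding the inner product releases \<open>2 * \<alpha>\<^sup>2\<close>, with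
  \<open>\<alpha>\<close> the norm of \<open>z\<^sub>1 - z\<^sub>0\<close>. This and the last term
  of the energy absorb the Young bounds for the product with \<open>Q\<^sub>0 - q\<close>, up to
  \<open>\<gamma> * \<mu>\<close> times the squared distance to \<open>p\<close>.\<close>

lemma reflected_energy_ge:
  fixes p z\<^sub>0 z\<^sub>1 y Q\<^sub>0 q :: "'a::real_inner" and \<gamma> \<mu> :: real
  assumes "0 \<le> \<gamma>" "0 \<le> \<mu>" "\<gamma> * \<mu> \<le> 1" and Q: "norm (Q\<^sub>0 - q) \<le> \<mu> * norm (y - p)"
  shows "(1 - \<gamma> * \<mu>) * (norm (z\<^sub>1 - p))\<^sup>2
    \<le> (norm (z\<^sub>1 - p))\<^sup>2 - 2 * ((z\<^sub>0 - z\<^sub>1 - \<gamma> *\<^sub>R Q\<^sub>0 + \<gamma> *\<^sub>R q) \<bullet> (z\<^sub>1 - z\<^sub>0)) + \<gamma> * \<mu> * (norm (z\<^sub>1 - y))\<^sup>2"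
proof -
  define a \<alpha> \<beta> where "a = norm (z\<^sub>1 - p)" and "\<alpha> = norm (z\<^sub>1 - z\<^sub>0)" and "\<beta> = norm (z\<^sub>1 - y)"
  define \<kappa> where "\<kappa> = \<gamma> * \<mu>"
  have k: "0 \<le> \<kappa>" "\<kappa> \<le> 1" using assms by (auto simp: \<kappa>_def)
  have "norm (y - p) \<le> \<beta> + a"
    using norm_triangle_ineq[of "y - z\<^sub>1" "z\<^sub>1 - p"] by (simp add: \<beta>_def a_def norm_minus_commute)
  then have "norm (Q\<^sub>0 - q) \<le> \<mu> * (\<beta> + a)" using Q \<open>0 \<le> \<mu>\<close> by (meson mult_left_mono order_trans)
  then have "norm (Q\<^sub>0 - q) * \<alpha> \<le> \<mu> * (\<beta> + a) * \<alpha>" by (rule mult_right_mono) (simp add: \<alpha>_def)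
  then have "- ((Q\<^sub>0 - q) \<bullet> (z\<^sub>1 - z\<^sub>0)) \<le> \<mu> * (\<beta> + a) * \<alpha>"
    using Cauchy_Schwarz_ineq2[of "Q\<^sub>0 - q" "z\<^sub>1 - z\<^sub>0"] by (simp add: \<alpha>_def)
  then have "\<gamma> * - ((Q\<^sub>0 - q) \<bullet> (z\<^sub>1 - z\<^sub>0)) \<le> \<gamma> * (\<mu> * (\<beta> + a) * \<alpha>)"
    using \<open>0 \<le> \<gamma>\<close> by (rule mult_left_mono)
  then have 1: "- 2 * \<gamma> * ((Q\<^sub>0 - q) \<bullet> (z\<^sub>1 - z\<^sub>0)) \<le> \<kappa> * (2 * \<beta> * \<alpha> + 2 * a * \<alpha>)"
    by (simp add: \<kappa>_def algebra_simps)
  also have "\<dots> \<le> \<kappa> * ((\<beta>\<^sup>2 + \<alpha>\<^sup>2) + (a\<^sup>2 + \<alpha>\<^sup>2))"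
    using k(1) by (intro mult_left_mono add_mono sum_squares_bound)
  also have "\<dots> \<le> \<kappa> * \<beta>\<^sup>2 + \<kappa> * a\<^sup>2 + 2 * \<alpha>\<^sup>2"
    using mult_right_mono[OF k(2), of "\<alpha>\<^sup>2"] by (simp add: algebra_simps)
  finally have "- 2 * \<gamma> * ((Q\<^sub>0 - q) \<bullet> (z\<^sub>1 - z\<^sub>0)) \<le> \<kappa> * \<beta>\<^sup>2 + \<kappa> * a\<^sup>2 + 2 * \<alpha>\<^sup>2" .
  moreover have "(z\<^sub>0 - z\<^sub>1 - \<gamma> *\<^sub>R Q\<^sub>0 + \<gamma> *\<^sub>R q) \<bullet> (z\<^sub>1 - z\<^sub>0) = - \<alpha>\<^sup>2 - \<gamma> * ((Q\<^sub>0 - q) \<bullet> (z\<^sub>1 - z\<^sub>0))"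
    by (simp add: \<alpha>_def power2_norm_eq_inner algebra_simps inner_commute)
  ultimately show ?thesis
    unfolding a_def[symmetric] \<beta>_def[symmetric] \<kappa>_def[symmetric] by (simp add: algebra_simps)
qed

text \<open>
  Replaces the maximality of \<open>M + Q\<close>: test the assumption at the fixed point \<open>a\<close> of the
  contraction \<open>a \<mapsto> J (l - \<gamma> Q a)\<close>, \<open>J\<close> the resolvent of \<open>\<gamma> M\<close>.
\<close>

lemma zero_of_monotonically_related:
  fixes M :: "'a::real_inner \<Rightarrow> 'a set" and Q :: "'a \<Rightarrow> 'a"
  assumes S: "subspace S" "complete S"
    and M: "monotone_op M" and J: "\<And>w. w \<in> S \<Longrightarrow> \<exists>p\<in>S. (1 / \<gamma>) *\<^sub>R (w - p) \<in> M p"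
    and Q: "\<mu>-lipschitz_on S Q" "Q \<in> S \<rightarrow> S" and \<gamma>: "0 < \<gamma>" "\<gamma> * \<mu> < 1"
    and l: "l \<in> S" and rel: "\<And>a b. a \<in> S \<Longrightarrow> b \<in> M a \<Longrightarrow> (Q a + b) \<bullet> (l - a) \<le> 0"
  shows "- Q l \<in> M l"
proof -
  obtain R where R: "\<And>w. w \<in> S \<Longrightarrow> R w \<in> S" "\<And>w. w \<in> S \<Longrightarrow> (1 / \<gamma>) *\<^sub>R (w - R w) \<in> M (R w)"
    using J by metis
  have nonexp: "norm (R w - R w') \<le> norm (w - w')" if "w \<in> S" "w' \<in> S" for w w'
  proof -
    have "0 \<le> (R w - R w') \<bullet> ((1 / \<gamma>) *\<^sub>R (w - R w) - (1 / \<gamma>) *\<^sub>R (w' - R w'))"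
      using monotone_opD[OF M] R that by blast
    also have "\<dots> = (1 / \<gamma>) * ((R w - R w') \<bullet> (w - w') - (norm (R w - R w'))\<^sup>2)"
      by (simp add: power2_norm_eq_inner algebra_simps inner_commute)
    finally have "(norm (R w - R w'))\<^sup>2 \<le> (R w - R w') \<bullet> (w - w')"
      using \<gamma>(1) by (simp add: zero_le_divide_iff)
    also have "\<dots> \<le> norm (R w - R w') * norm (w - w')" by (rule norm_cauchy_schwarz)
    finally show ?thesis
      by (metis mult_left_le_imp_le norm_ge_zero order_le_less power2_eq_square)
  qed
  have wS: "l - \<gamma> *\<^sub>R Q a \<in> S" if "a \<in> S" for a
    using that l Q(2) by (intro subspace_diff subspace_scale S(1)) auto
  have "\<exists>!a\<in>S. R (l - \<gamma> *\<^sub>R Q a) = a"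
  proof (rule Banach_fix[OF S(2) _ _ \<gamma>(2)])
    show "S \<noteq> {}" using l by blast
    show "0 \<le> \<gamma> * \<mu>" using \<gamma>(1) lipschitz_on_nonneg[OF Q(1)] by simp
    show "(\<lambda>a. R (l - \<gamma> *\<^sub>R Q a)) ` S \<subseteq> S" using wS R(1) by blast
    show "dist (R (l - \<gamma> *\<^sub>R Q a)) (R (l - \<gamma> *\<^sub>R Q b)) \<le> \<gamma> * \<mu> * dist a b" if "a \<in> S" "b \<in> S" for a b
    proof -
      have "dist (R (l - \<gamma> *\<^sub>R Q a)) (R (l - \<gamma> *\<^sub>R Q b)) \<le> norm (\<gamma> *\<^sub>R (Q b - Q a))"
        using nonexp[OF wS wS, OF that] by (simp add: dist_norm algebra_simps)
      also have "\<dots> = \<gamma> * dist (Q a) (Q b)" using \<gamma>(1) by (simp add: dist_norm norm_minus_commute)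
      also have "\<dots> \<le> \<gamma> * (\<mu> * dist a b)"
        using lipschitz_onD[OF Q(1) that] \<gamma>(1) by (intro mult_left_mono) auto
      finally show ?thesis by simp
    qed
  qed
  then obtain a where a: "a \<in> S" "R (l - \<gamma> *\<^sub>R Q a) = a" by blast
  define b where "b = (1 / \<gamma>) *\<^sub>R (l - \<gamma> *\<^sub>R Q a - a)"
  have b: "b \<in> M a" using R(2)[OF wS[OF a(1)]] a(2) by (simp add: b_def)
  \<comment> \<open>At the fixed point the tested pair gives a multiple of \<open>l - a\<close>,
    which turns \<open>rel\<close> into a bound on the norm of \<open>l - a\<close>.\<close>
  have Qb: "Q a + b = (1 / \<gamma>) *\<^sub>R (l - a)" using \<gamma>(1) by (simp add: b_def algebra_simps)
  have "(1 / \<gamma>) * ((l - a) \<bullet> (l - a)) \<le> 0" using rel[OF a(1) b] by (simp add: Qb)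
  then have "(l - a) \<bullet> (l - a) \<le> 0" using \<gamma>(1) by (simp add: divide_le_0_iff)
  then have "l = a" by (metis inner_eq_zero_iff inner_ge_zero order_antisym right_minus_eq)
  then have "b = - Q l" using Qb by (simp add: eq_neg_iff_add_eq_0 add.commute)
  then show ?thesis using b \<open>l = a\<close> by simp
qed

text \<open>The resolvent enters through the solvability assumption \<open>J\<close> and the
  iteration as an inclusion. Limits are tested against \<open>w \<in> S\<close> only, which is weak
  convergence in the Hilbert space \<open>S\<close>.\<close>

theorem reflected_forward_backward:
  fixes M :: "'a::real_inner \<Rightarrow> 'a set" and Q :: "'a \<Rightarrow> 'a" and z :: "nat \<Rightarrow> 'a"
  assumes S: "subspace S" "complete S"
    and M: "monotone_op M" "gra_op M \<subseteq> S \<times> S" and J: "\<And>w. w \<in> S \<Longrightarrow> \<exists>p\<in>S. (1 / \<gamma>) *\<^sub>R (w - p) \<in> M p"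
    and Q: "\<mu>-lipschitz_on S Q" "Q \<in> S \<rightarrow> S"
      "\<And>a b. a \<in> S \<Longrightarrow> b \<in> S \<Longrightarrow> 0 \<le> (Q a - Q b) \<bullet> (a - b)"
    and \<gamma>: "0 < \<gamma>" "\<gamma> * \<mu> < sqrt 2 - 1"
    and zero: "p \<in> S" "- Q p \<in> M p"
    and z: "\<And>n. z n \<in> S"
    and step: "\<And>n. (1 / \<gamma>) *\<^sub>R (z (Suc n) - \<gamma> *\<^sub>R Q (2 *\<^sub>R z (Suc n) - z n) - z (Suc (Suc n)))
      \<in> M (z (Suc (Suc n)))"
  obtains l where "l \<in> S" "- Q l \<in> M l" "\<And>w. w \<in> S \<Longrightarrow> (\<lambda>n. z n \<bullet> w) \<longlonglongrightarrow> l \<bullet> w"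
proof -
  have \<mu>0: "0 \<le> \<mu>" using Q(1) by (rule lipschitz_on_nonneg)
  define \<kappa> where "\<kappa> = \<gamma> * \<mu>"
  have k0: "0 \<le> \<kappa>" using \<gamma>(1) \<mu>0 by (simp add: \<kappa>_def)
  have "sqrt 2 < (2::real)" by (simp add: real_less_lsqrt)
  then have k1: "\<kappa> < 1" using \<gamma>(2) unfolding \<kappa>_def by linarith
  define c where "c = 1 - \<kappa> * (1 + sqrt 2)"
  have c: "0 < c"
  proof -
    have "\<kappa> * (1 + sqrt 2) < (sqrt 2 - 1) * (1 + sqrt 2)"
      using \<gamma>(2) by (intro mult_strict_right_mono) (auto simp: \<kappa>_def add_pos_pos)
    also have "\<dots> = 1" by (simp add: algebra_simps flip: power2_eq_square)
    finally show ?thesis by (simp add: c_def)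
  qed
  define y where "y n = 2 *\<^sub>R z (Suc n) - z n" for n
  \<comment> \<open>\<open>z 0\<close> and \<open>z 1\<close> are arbitrary points of
    \<open>S\<close>, so an element of \<open>M\<close> is known only from
    \<open>z (Suc (Suc n))\<close> on. The energies therefore start at the third term.\<close>
  define U where "U n = z (Suc n) - z (Suc (Suc n)) - \<gamma> *\<^sub>R Q (y n)" for n
  have yS: "y n \<in> S" for n using z S(1) by (simp add: y_def subspace_diff subspace_scale)
  have U: "(1 / \<gamma>) *\<^sub>R U n \<in> M (z (Suc (Suc n)))" for n
    using step[of n] by (simp add: U_def y_def algebra_simps)
  have lip: "norm (Q a - Q b) \<le> \<mu> * norm (a - b)" if "a \<in> S" "b \<in> S" for a b
    using lipschitz_onD[OF Q(1) that] by (simp add: dist_norm)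
  define Z where "Z = {p \<in> S. - Q p \<in> M p}"
  define E where "E p n = (norm (z (Suc (Suc n)) - p))\<^sup>2
      - 2 * ((U n + \<gamma> *\<^sub>R Q p) \<bullet> (z (Suc (Suc n)) - z (Suc n))) + \<kappa> * (norm (z (Suc (Suc n)) - y n))\<^sup>2" for p n
  have E_step: "E p (Suc n) + c * ((norm (z (Suc (Suc n)) - z (Suc n)))\<^sup>2 + (norm (z (Suc (Suc (Suc n))) - y (Suc n)))\<^sup>2)
      \<le> E p n" if p: "p \<in> Z" for p n
  proof -
    have pS: "p \<in> S" and pM: "- Q p \<in> M p" using p by (auto simp: Z_def)
    have sc: "0 \<le> (u + \<gamma> *\<^sub>R v) \<bullet> (a - b)" if "0 \<le> (a - b) \<bullet> ((1 / \<gamma>) *\<^sub>R u + v)" for a b u v :: 'a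
    proof -
      have "(u + \<gamma> *\<^sub>R v) \<bullet> (a - b) = \<gamma> * ((a - b) \<bullet> ((1 / \<gamma>) *\<^sub>R u + v))"
        using \<gamma>(1) by (simp add: algebra_simps inner_commute)
      then show ?thesis using that \<gamma>(1) by simp
    qed
    have 1: "0 \<le> (U (Suc n) + \<gamma> *\<^sub>R Q p) \<bullet> (z (Suc (Suc (Suc n))) - p)"
      using monotone_opD[OF M(1) U pM, of "Suc n"] by (intro sc) simp
    have 2: "0 \<le> (U (Suc n) - U n) \<bullet> (z (Suc (Suc (Suc n))) - z (Suc (Suc n)))"
      using monotone_opD[OF M(1) U U, of "Suc n" n] sc[of "z (Suc (Suc (Suc n)))" "z (Suc (Suc n))" "U (Suc n) - U n" 0]
      by (simp add: scaleR_diff_right)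
    have 3: "0 \<le> (Q (y (Suc n)) - Q p) \<bullet> (y (Suc n) - p)" using Q(3) yS pS by blast
    show ?thesis
      using reflected_step_energy[of \<gamma> \<mu> "z (Suc (Suc n))" "z (Suc (Suc (Suc n)))" "Q (y (Suc n))" "Q p" p
          "z (Suc n)" "Q (y n)" "y n"] 1 2 3 lip[OF yS yS, of "Suc n" n] \<gamma>(1) \<mu>0 c
      by (simp add: U_def y_def E_def c_def \<kappa>_def)
  qed
  have E_ge: "(1 - \<kappa>) * (norm (z (Suc (Suc n)) - p))\<^sup>2 \<le> E p n" if p: "p \<in> Z" for p n
    using reflected_energy_ge[of \<gamma> \<mu> "Q (y n)" "Q p" "y n" p "z (Suc (Suc n))" "z (Suc n)"]
      \<gamma>(1) \<mu>0 k1 lip[OF yS, of p n] p by (simp add: E_def U_def \<kappa>_def Z_def)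
  have pZ: "p \<in> Z" using zero by (simp add: Z_def)
  have E_conv: "convergent (E p)" if p: "p \<in> Z" for p
  proof -
    have "decseq (E p)"
    proof (rule decseq_SucI)
      show "E p (Suc n) \<le> E p n" for n
      proof -
        have "0 \<le> c * ((norm (z (Suc (Suc n)) - z (Suc n)))\<^sup>2 + (norm (z (Suc (Suc (Suc n))) - y (Suc n)))\<^sup>2)"
          using c by (intro mult_nonneg_nonneg add_nonneg_nonneg) auto
        then show ?thesis using E_step[OF p, of n] by linarith
      qed
    qed
    moreover have "0 \<le> E p n" for n
      by (rule order_trans[OF _ E_ge[OF p]]) (use k1 in simp)
    ultimately show ?thesis by (metis convergent_def decseq_convergent)
  qed
  define D where "D n = (norm (z (Suc (Suc n)) - z (Suc n)))\<^sup>2 + (norm (z (Suc (Suc (Suc n))) - y (Suc n)))\<^sup>2" for n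
  have D: "D \<longlonglongrightarrow> 0"
  proof (rule Lim_null_comparison)
    obtain e where e: "E p \<longlonglongrightarrow> e" using E_conv[OF pZ] by (auto simp: convergent_def)
    have "(\<lambda>n. (E p n - E p (Suc n)) / c) \<longlonglongrightarrow> (e - e) / c"
      using c by (intro tendsto_intros e LIMSEQ_Suc) auto
    then show "(\<lambda>n. (E p n - E p (Suc n)) / c) \<longlonglongrightarrow> 0" by simp
    show "\<forall>\<^sub>F n in sequentially. norm (D n) \<le> (E p n - E p (Suc n)) / c"
      using E_step[OF pZ] c by (auto simp: D_def pos_le_divide_eq algebra_simps)
  qed
  have sq0: "f \<longlonglongrightarrow> 0" if "\<And>n. (norm (f n))\<^sup>2 \<le> D n" for f :: "nat \<Rightarrow> 'a"
  proof -
    have "(\<lambda>n. (norm (f n))\<^sup>2) \<longlonglongrightarrow> 0"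
      by (rule Lim_null_comparison[OF _ D]) (use that in auto)
    then have "(\<lambda>n. norm (f n)) \<longlonglongrightarrow> 0" by simp
    then show ?thesis by (simp add: tendsto_norm_zero_iff)
  qed
  have step0: "(\<lambda>n. z (Suc (Suc n)) - z (Suc n)) \<longlonglongrightarrow> 0" by (rule sq0) (simp add: D_def)
  have "(\<lambda>n. z (Suc (Suc (Suc n))) - y (Suc n)) \<longlonglongrightarrow> 0" by (rule sq0) (simp add: D_def)
  then have refl0: "(\<lambda>n. z (Suc (Suc n)) - y n) \<longlonglongrightarrow> 0" by (rule LIMSEQ_imp_Suc)
  have Qdiff0: "(\<lambda>n. Q (z (Suc (Suc n))) - Q (y n)) \<longlonglongrightarrow> 0"
  proof (rule Lim_null_comparison)
    show "\<forall>\<^sub>F n in sequentially. norm (Q (z (Suc (Suc n))) - Q (y n)) \<le> \<mu> * norm (z (Suc (Suc n)) - y n)"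
      using lip z yS by auto
    show "(\<lambda>n. \<mu> * norm (z (Suc (Suc n)) - y n)) \<longlonglongrightarrow> 0"
      using tendsto_mult_left[OF tendsto_norm[OF refl0], of \<mu>] by simp
  qed
  obtain R where R: "\<And>n. norm (z (Suc (Suc n))) \<le> R"
  proof -
    obtain K where K: "\<And>n. norm (E p n) \<le> K" using convergent_imp_Bseq[OF E_conv[OF pZ]] by (auto simp: Bseq_def)
    have "norm (z (Suc (Suc n))) \<le> sqrt (K / (1 - \<kappa>)) + norm p" for n
    proof -
      have "(1 - \<kappa>) * (norm (z (Suc (Suc n)) - p))\<^sup>2 \<le> K" using E_ge[OF pZ, of n] K[of n] by simp
      then have "norm (z (Suc (Suc n)) - p) \<le> sqrt (K / (1 - \<kappa>))"
        using k1 by (intro real_le_rsqrt) (simp add: pos_le_divide_eq mult.commute)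
      then show ?thesis using norm_triangle_sub[of "z (Suc (Suc n))" p] by linarith
    qed
    then show ?thesis using that by blast
  qed
  have inner0: "((\<lambda>n. f n \<bullet> g n) \<longlongrightarrow> 0) sequentially" if "f \<longlonglongrightarrow> 0" "\<And>n. norm (g n) \<le> K" for f g :: "nat \<Rightarrow> 'a" and K
  proof (rule Lim_null_comparison)
    show "\<forall>\<^sub>F n in sequentially. norm (f n \<bullet> g n) \<le> norm (f n) * K"
      using that(2) by (auto intro!: always_eventually order_trans[OF Cauchy_Schwarz_ineq2] mult_left_mono)
    show "(\<lambda>n. norm (f n) * K) \<longlonglongrightarrow> 0" using tendsto_mult_right[OF tendsto_norm[OF that(1)], of K] by simp
  qed
  \<comment> \<open>\<open>E p\<close> differs from the squared distance by a multiple of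
    \<open>norm (z (Suc (Suc n)) - y n)\<close> squared and an inner product of a vanishing
    increment with \<open>h n\<close>. The latter is bounded, since
    \<open>U n + \<gamma> Q z\<close> tends to 0 at the current iterate and \<open>Q\<close> is
    Lipschitzian on the bounded iterates.\<close>
  have conv: "convergent (\<lambda>n. norm (z (Suc (Suc n)) - p))" if p: "p \<in> Z" for p
  proof -
    obtain e where e: "E p \<longlonglongrightarrow> e" using E_conv[OF p] by (auto simp: convergent_def)
    have pS: "p \<in> S" using p by (simp add: Z_def)
    have "(\<lambda>n. U n + \<gamma> *\<^sub>R Q (z (Suc (Suc n)))) \<longlonglongrightarrow> - 0 + \<gamma> *\<^sub>R 0"
      unfolding U_def
      by (rule Lim_transform_eventually[OF tendsto_add[OF tendsto_minus[OF step0] tendsto_scaleR[OF tendsto_const Qdiff0]]])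
        (simp add: algebra_simps)
    then have r0: "(\<lambda>n. U n + \<gamma> *\<^sub>R Q (z (Suc (Suc n)))) \<longlonglongrightarrow> 0" by simp
    define h where "h = (\<lambda>n. U n + \<gamma> *\<^sub>R Q p)"
    have hb: "norm (h n) \<le> norm (U n + \<gamma> *\<^sub>R Q (z (Suc (Suc n)))) + \<gamma> * (\<mu> * (R + norm p))" for n
    proof -
      have "norm (Q p - Q (z (Suc (Suc n)))) \<le> \<mu> * (R + norm p)"
      proof (rule order_trans[OF lip[OF pS z] mult_left_mono[OF _ \<mu>0]])
        show "norm (p - z (Suc (Suc n))) \<le> R + norm p"
          using norm_triangle_ineq4[of p "z (Suc (Suc n))"] R[of n] by linarith
      qed
      then have "norm (\<gamma> *\<^sub>R (Q p - Q (z (Suc (Suc n))))) \<le> \<gamma> * (\<mu> * (R + norm p))" using \<gamma>(1) by simp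
      moreover have "h n = (U n + \<gamma> *\<^sub>R Q (z (Suc (Suc n)))) + \<gamma> *\<^sub>R (Q p - Q (z (Suc (Suc n))))"
        by (simp add: h_def algebra_simps)
      ultimately show ?thesis by (metis add_left_mono norm_triangle_le)
    qed
    obtain K where K: "\<And>n. norm (U n + \<gamma> *\<^sub>R Q (z (Suc (Suc n)))) \<le> K"
      using convergent_imp_Bseq[of "\<lambda>n. U n + \<gamma> *\<^sub>R Q (z (Suc (Suc n)))"] r0 by (auto simp: Bseq_def convergent_def)
    have "(\<lambda>n. (z (Suc (Suc n)) - z (Suc n)) \<bullet> h n) \<longlonglongrightarrow> 0"
      by (rule inner0[OF step0, of _ "K + \<gamma> * (\<mu> * (R + norm p))"]) (use hb K in \<open>meson add_right_mono order_trans\<close>)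
    then have "(\<lambda>n. E p n + 2 * ((z (Suc (Suc n)) - z (Suc n)) \<bullet> h n) - \<kappa> * (norm (z (Suc (Suc n)) - y n))\<^sup>2)
        \<longlonglongrightarrow> e + 2 * 0 - \<kappa> * (norm (0::'a))\<^sup>2"
      by (intro tendsto_intros e refl0)
    then have "(\<lambda>n. (norm (z (Suc (Suc n)) - p))\<^sup>2) \<longlonglongrightarrow> e" by (simp add: E_def h_def inner_commute)
    then have "(\<lambda>n. sqrt ((norm (z (Suc (Suc n)) - p))\<^sup>2)) \<longlonglongrightarrow> sqrt e" by (rule tendsto_real_sqrt)
    then show ?thesis by (auto simp: convergent_def)
  qed
  have cluster: "l \<in> Z"
    if F: "F \<le> sequentially" "F \<noteq> bot" and l: "l \<in> S"
      and lim: "\<forall>w\<in>S. ((\<lambda>n. z (Suc (Suc n)) \<bullet> w) \<longlongrightarrow> l \<bullet> w) F" for F l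
  proof -
    \<comment> \<open>\<open>r n\<close> is an element of \<open>(M + Q) (z (Suc (Suc n)))\<close>
      and tends to 0 in norm. Monotonicity of \<open>M + Q\<close> can thus be passed to the limit
      along iterates that converge only weakly.\<close>
    define r where "r n = (1 / \<gamma>) *\<^sub>R U n + Q (z (Suc (Suc n)))" for n
    have "(\<lambda>n. - ((1 / \<gamma>) *\<^sub>R (z (Suc (Suc n)) - z (Suc n))) + (Q (z (Suc (Suc n))) - Q (y n))) \<longlonglongrightarrow> - ((1 / \<gamma>) *\<^sub>R 0) + 0"
      by (intro tendsto_intros step0 Qdiff0)
    then have r0: "r \<longlonglongrightarrow> 0"
      using \<gamma>(1) by (simp add: r_def[abs_def] U_def algebra_simps)
    have "(Q a + b) \<bullet> (l - a) \<le> 0" if a: "a \<in> S" "b \<in> M a" for a b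
    proof -
      have bS: "b \<in> S" using M(2) a(2) by (auto simp: gra_op_def)
      have pos: "0 \<le> (r n - (Q a + b)) \<bullet> (z (Suc (Suc n)) - a)" for n
        using monotone_opD[OF M(1) U a(2), of n] Q(3)[OF z a(1), of "Suc (Suc n)"]
        by (simp add: r_def algebra_simps inner_commute)
      have "(\<lambda>n. r n \<bullet> (z (Suc (Suc n)) - a)) \<longlonglongrightarrow> 0"
        by (rule inner0[OF r0, of _ "R + norm a"])
          (use R in \<open>meson add_right_mono norm_triangle_ineq4 order_trans\<close>)
      then have 1: "((\<lambda>n. r n \<bullet> (z (Suc (Suc n)) - a)) \<longlongrightarrow> 0) F" by (rule tendsto_mono[OF F(1)])
      have "b \<bullet> w = b \<bullet> w" for w ..
      have 2: "((\<lambda>n. z (Suc (Suc n)) \<bullet> (Q a + b)) \<longlongrightarrow> l \<bullet> (Q a + b)) F"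
        by (intro bspec[OF lim] subspace_add S(1)) (use a(1) Q(2) bS in auto)
      have "((\<lambda>n. r n \<bullet> (z (Suc (Suc n)) - a) - (z (Suc (Suc n)) \<bullet> (Q a + b) - a \<bullet> (Q a + b)))
          \<longlongrightarrow> 0 - (l \<bullet> (Q a + b) - a \<bullet> (Q a + b))) F"
        by (intro tendsto_intros 1 2)
      then have "0 \<le> 0 - (l \<bullet> (Q a + b) - a \<bullet> (Q a + b))"
      proof (rule tendsto_lowerbound[OF _ _ F(2)])
        show "\<forall>\<^sub>F n in F. 0 \<le> r n \<bullet> (z (Suc (Suc n)) - a) - (z (Suc (Suc n)) \<bullet> (Q a + b) - a \<bullet> (Q a + b))"
          using pos by (auto intro!: always_eventually simp: algebra_simps inner_commute)
      qed
      then show ?thesis by (simp add: algebra_simps inner_commute)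
    qed
    then have "- Q l \<in> M l"
      using zero_of_monotonically_related[OF S M(1) J Q(1,2) \<gamma>(1) _ l] k1 by (simp add: \<kappa>_def)
    then show ?thesis using l by (simp add: Z_def)
  qed
  have "Z \<subseteq> S" "Z \<noteq> {}" using pZ by (auto simp: Z_def)
  then obtain l where l: "l \<in> Z" "\<And>w. w \<in> S \<Longrightarrow> (\<lambda>n. z (Suc (Suc n)) \<bullet> w) \<longlonglongrightarrow> l \<bullet> w"
  proof (rule opial[OF S, of Z "\<lambda>n. z (Suc (Suc n))"])
    show "convergent (\<lambda>n. norm (z (Suc (Suc n)) - p))" if "p \<in> Z" for p
      using that by (rule conv)
    show "l \<in> Z" if "F \<le> sequentially" "F \<noteq> bot" "l \<in> S"
      "\<forall>w\<in>S. ((\<lambda>n. z (Suc (Suc n)) \<bullet> w) \<longlongrightarrow> l \<bullet> w) F" for F l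
      using that by (rule cluster)
  qed blast
  have "(\<lambda>n. z n \<bullet> w) \<longlonglongrightarrow> l \<bullet> w" if "w \<in> S" for w
    using LIMSEQ_imp_Suc[OF LIMSEQ_imp_Suc[OF l(2)[OF that]]] .
  then show ?thesis using that l(1) by (auto simp: Z_def)
qed

section \<open>Finite direct sums\<close>

abbreviation "lookup \<equiv> Poly_Mapping.lookup"

abbreviation "keys \<equiv> Poly_Mapping.keys"

text \<open>
  A direct sum over an index set whose size varies inside the statement is carried by
  the finitely supported functions, as a type that does not depend on \<open>m\<close>.
\<close>

instantiation poly_mapping :: (type, real_vector) real_vector
begin

lift_definition scaleR_poly_mapping :: "real \<Rightarrow> ('a \<Rightarrow>\<^sub>0 'b) \<Rightarrow> 'a \<Rightarrow>\<^sub>0 'b"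
  is "\<lambda>c f k. c *\<^sub>R f k"
  by (rule finite_subset) auto

instance
  by intro_classes (transfer, simp add: fun_eq_iff algebra_simps)+

end

lemma lookup_scaleR [simp]: "lookup (c *\<^sub>R f) i = c *\<^sub>R lookup f i"
  by transfer simp

instantiation poly_mapping :: (type, real_inner) real_inner
begin

definition inner_poly_mapping :: "('a \<Rightarrow>\<^sub>0 'b) \<Rightarrow> ('a \<Rightarrow>\<^sub>0 'b) \<Rightarrow> real" where
  "f \<bullet> g = (\<Sum>i\<in>keys f. lookup f i \<bullet> lookup g i)"

definition norm_poly_mapping :: "('a \<Rightarrow>\<^sub>0 'b) \<Rightarrow> real" where
  "norm_poly_mapping f = sqrt (f \<bullet> f)"

definition sgn_poly_mapping :: "('a \<Rightarrow>\<^sub>0 'b) \<Rightarrow> 'a \<Rightarrow>\<^sub>0 'b" where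
  "sgn_poly_mapping f = f /\<^sub>R norm f"

definition dist_poly_mapping :: "('a \<Rightarrow>\<^sub>0 'b) \<Rightarrow> ('a \<Rightarrow>\<^sub>0 'b) \<Rightarrow> real" where
  "dist_poly_mapping f g = norm (f - g)"

definition uniformity_poly_mapping :: "(('a \<Rightarrow>\<^sub>0 'b) \<times> ('a \<Rightarrow>\<^sub>0 'b)) filter" where
  "uniformity_poly_mapping = (INF e\<in>{0<..}. principal {(f, g). dist f g < e})"

definition open_poly_mapping :: "('a \<Rightarrow>\<^sub>0 'b) set \<Rightarrow> bool" where
  "open_poly_mapping U = (\<forall>f\<in>U. \<forall>\<^sub>F (f', g) in uniformity. f' = f \<longrightarrow> g \<in> U)"

text \<open>Moves all sums to one finite index set, which removes the asymmetry of summing over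
  \<open>keys f\<close>.\<close>

lemma inner_poly_mapping_superset:
  assumes "finite I" "keys f \<subseteq> I"
  shows "f \<bullet> g = (\<Sum>i\<in>I. lookup f i \<bullet> lookup g i)"
  unfolding inner_poly_mapping_def
  using assms by (intro sum.mono_neutral_left) (auto simp: in_keys_iff)

instance
proof
  fix f g h :: "'a \<Rightarrow>\<^sub>0 'b" and c :: real
  define I where "I = keys f \<union> keys g \<union> keys (f + g) \<union> keys (c *\<^sub>R f)"
  have I: "finite I" "keys f \<subseteq> I" "keys g \<subseteq> I" "keys (f + g) \<subseteq> I" "keys (c *\<^sub>R f) \<subseteq> I"
    by (auto simp: I_def)
  note sums = I(2-5)[THEN inner_poly_mapping_superset[OF I(1)]]
  show "f \<bullet> g = g \<bullet> f" by (simp add: sums inner_commute)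
  show "(f + g) \<bullet> h = f \<bullet> h + g \<bullet> h"
    by (simp add: sums lookup_add inner_add_left sum.distrib)
  show "(c *\<^sub>R f) \<bullet> g = c * (f \<bullet> g)" by (simp add: sums sum_distrib_left)
  show "0 \<le> f \<bullet> f" by (simp add: inner_poly_mapping_def sum_nonneg)
  show "f \<bullet> f = 0 \<longleftrightarrow> f = 0"
  proof
    assume "f \<bullet> f = 0"
    then have "\<forall>i\<in>keys f. lookup f i \<bullet> lookup f i = 0"
      unfolding inner_poly_mapping_def by (subst (asm) sum_nonneg_eq_0_iff) auto
    then show "f = 0" by (intro poly_mapping_eqI) (auto simp: in_keys_iff)
  qed (simp add: inner_poly_mapping_def)
qed (simp_all add: norm_poly_mapping_def sgn_poly_mapping_def dist_poly_mapping_def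
    uniformity_poly_mapping_def open_poly_mapping_def)

end

lemma norm_poly_mapping_superset:
  fixes f :: "'i \<Rightarrow>\<^sub>0 'a::real_inner"
  assumes "finite I" "keys f \<subseteq> I"
  shows "(norm f)\<^sup>2 = (\<Sum>i\<in>I. (norm (lookup f i))\<^sup>2)"
  by (simp add: power2_norm_eq_inner inner_poly_mapping_superset[OF assms])

lemma norm_lookup_le:
  fixes f :: "'i \<Rightarrow>\<^sub>0 'a::real_inner"
  shows "norm (lookup f i) \<le> norm f"
proof (rule power2_le_imp_le)
  show "(norm (lookup f i))\<^sup>2 \<le> (norm f)\<^sup>2"
    using member_le_sum[of i "insert i (keys f)" "\<lambda>i. (norm (lookup f i))\<^sup>2"]
    by (subst norm_poly_mapping_superset[of "insert i (keys f)"]) auto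
qed simp

text \<open>Confining the support to \<open>I\<close> is what yields completeness for finite
  \<open>I\<close>; the space of all finitely supported functions is in general incomplete.\<close>

definition direct_sum :: "'i set \<Rightarrow> ('i \<Rightarrow> 'a::real_inner set) \<Rightarrow> ('i \<Rightarrow>\<^sub>0 'a) set" where
  "direct_sum I G = {f. keys f \<subseteq> I \<and> (\<forall>i\<in>I. lookup f i \<in> G i)}"

definition family :: "'i set \<Rightarrow> ('i \<Rightarrow> 'a::real_inner) \<Rightarrow> 'i \<Rightarrow>\<^sub>0 'a" where
  "family I f = Abs_poly_mapping (\<lambda>i. if i \<in> I then f i else 0)"

lemma lookup_family [simp]: "finite I \<Longrightarrow> lookup (family I f) i = (if i \<in> I then f i else 0)"
  unfolding family_def by (subst lookup_Abs_poly_mapping) auto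

lemma keys_family: "finite I \<Longrightarrow> keys (family I f) \<subseteq> I"
  by (auto simp: in_keys_iff split: if_splits)

lemma family_in_direct_sum:
  assumes "finite I" "\<And>i. i \<in> I \<Longrightarrow> f i \<in> G i"
  shows "family I f \<in> direct_sum I G"
  using assms keys_family[OF assms(1)] by (auto simp: direct_sum_def)

lemma inner_direct_sum:
  assumes "finite I" "f \<in> direct_sum I G"
  shows "f \<bullet> g = (\<Sum>i\<in>I. lookup f i \<bullet> lookup g i)"
  using assms by (intro inner_poly_mapping_superset) (auto simp: direct_sum_def)

lemma subspace_direct_sum:
  assumes "\<And>i. i \<in> I \<Longrightarrow> subspace (G i)"
  shows "subspace (direct_sum I G)"
proof (rule subspaceI)
  show "0 \<in> direct_sum I G" using assms by (auto simp: direct_sum_def subspace_0)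
  show "f + g \<in> direct_sum I G" if "f \<in> direct_sum I G" "g \<in> direct_sum I G" for f g
    using that assms keys_add[of f g] by (auto simp: direct_sum_def lookup_add subspace_add)
  show "c *\<^sub>R f \<in> direct_sum I G" if "f \<in> direct_sum I G" for c f
    using that assms by (auto simp: direct_sum_def subspace_scale in_keys_iff subset_iff)
qed

lemma complete_direct_sum:
  assumes "finite I" and G: "\<And>i. i \<in> I \<Longrightarrow> subspace (G i) \<and> complete (G i)"
  shows "complete (direct_sum I G)"
  unfolding complete_def
proof (intro allI impI, elim conjE)
  fix f :: "nat \<Rightarrow> 'a \<Rightarrow>\<^sub>0 'b"
  assume f: "\<forall>n. f n \<in> direct_sum I G" and "Cauchy f"
  have "Cauchy (\<lambda>n. lookup (f n) i)" for i
  proof (rule metric_CauchyI)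
    fix e :: real assume "0 < e"
    then obtain N where "\<And>k n. k \<ge> N \<Longrightarrow> n \<ge> N \<Longrightarrow> dist (f k) (f n) < e"
      using \<open>Cauchy f\<close> unfolding Cauchy_def by metis
    then have "\<forall>k\<ge>N. \<forall>n\<ge>N. dist (lookup (f k) i) (lookup (f n) i) < e"
      using norm_lookup_le[of "f _ - f _" i] unfolding dist_norm
      by (metis le_less_trans lookup_minus)
    then show "\<exists>N. \<forall>k\<ge>N. \<forall>n\<ge>N. dist (lookup (f k) i) (lookup (f n) i) < e" by blast
  qed
  then have "\<forall>i\<in>I. \<exists>l\<in>G i. (\<lambda>n. lookup (f n) i) \<longlonglongrightarrow> l"
    using f G by (auto simp: complete_def direct_sum_def)
  then obtain l where l: "\<And>i. i \<in> I \<Longrightarrow> l i \<in> G i" "\<And>i. i \<in> I \<Longrightarrow> (\<lambda>n. lookup (f n) i) \<longlonglongrightarrow> l i"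
    by metis
  have L: "family I l \<in> direct_sum I G" using assms(1) l(1) by (rule family_in_direct_sum)
  have diff: "f n - family I l \<in> direct_sum I G" for n
    using f L subspace_direct_sum[of I G] G by (simp add: subspace_diff)
  have "(\<lambda>n. \<Sum>i\<in>I. (norm (lookup (f n) i - l i))\<^sup>2) \<longlonglongrightarrow> (\<Sum>i\<in>I. (norm (l i - l i))\<^sup>2)"
    by (intro tendsto_intros l(2))
  also have "(\<lambda>n. \<Sum>i\<in>I. (norm (lookup (f n) i - l i))\<^sup>2) = (\<lambda>n. (norm (f n - family I l))\<^sup>2)"
    using diff assms(1)
    by (auto simp: norm_poly_mapping_superset[OF assms(1)] direct_sum_def lookup_minus)
  finally have "(\<lambda>n. norm (f n - family I l)) \<longlonglongrightarrow> 0" by simp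
  then have "f \<longlonglongrightarrow> family I l" by (simp add: tendsto_norm_zero_iff LIM_zero_iff)
  then show "\<exists>l\<in>direct_sum I G. f \<longlonglongrightarrow> l" using L by blast
qed

section \<open>Primal-dual splitting\<close>

text \<open>Unfolding the Minkowski sums exposes the dual variables \<open>u\<close>, with
  \<open>c\<close> an element of the inverse of \<open>Bs i\<close> at \<open>u i\<close>. The same
  conditions say that \<open>u\<close> is a dual solution and that \<open>(x, u)\<close> is a zero
  of \<open>M + Q\<close>.\<close>

lemma solves_primal_iff:
  "solves_primal m A B As Bs L x \<longleftrightarrow>
    (\<exists>u. - (B x + (\<Sum>i=1..m. adjoint (L i) (u i))) \<in> A x \<and>
      (\<forall>i\<in>{1..m}. \<exists>c. u i \<in> Bs i c \<and> u i \<in> As i (L i x - c)))"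
  (is "_ \<longleftrightarrow> ?rhs")
proof
  assume "solves_primal m A B As Bs L x"
  then obtain a s where a: "a \<in> A x" "0 = a + s + B x"
    and s: "s \<in> (\<Sum>i=1..m. adjoint (L i) ` parallel_sum (As i) (Bs i) (L i x))"
    by (auto simp: solves_primal_def primal_op_def set_plus_def)
  from s obtain t where t: "s = sum t {1..m}"
    "\<forall>i\<in>{1..m}. t i \<in> adjoint (L i) ` parallel_sum (As i) (Bs i) (L i x)"
    unfolding set_sum_alt[OF finite_atLeastAtMost] by blast
  then obtain u where u: "\<And>i. i \<in> {1..m} \<Longrightarrow> t i = adjoint (L i) (u i)"
    "\<And>i. i \<in> {1..m} \<Longrightarrow> u i \<in> parallel_sum (As i) (Bs i) (L i x)"
    unfolding image_iff by metis
  have "s = (\<Sum>i=1..m. adjoint (L i) (u i))" unfolding t(1) using u(1) by (rule sum.cong[OF refl])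
  then have "- (B x + (\<Sum>i=1..m. adjoint (L i) (u i))) = a" using a(2) by (simp add: algebra_simps add_eq_0_iff)
  moreover have "\<exists>c. u i \<in> Bs i c \<and> u i \<in> As i (L i x - c)" if "i \<in> {1..m}" for i
    using u(2)[OF that] by (force simp: parallel_sum_def inv_op_def set_plus_def)
  ultimately show ?rhs using a(1) by blast
next
  assume ?rhs
  then obtain u where u: "- (B x + (\<Sum>i=1..m. adjoint (L i) (u i))) \<in> A x"
    "\<And>i. i \<in> {1..m} \<Longrightarrow> \<exists>c. u i \<in> Bs i c \<and> u i \<in> As i (L i x - c)" by blast
  have "u i \<in> parallel_sum (As i) (Bs i) (L i x)" if i: "i \<in> {1..m}" for i
  proof -
    obtain c where "u i \<in> Bs i c" "u i \<in> As i (L i x - c)" using u(2)[OF i] by blast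
    then have "(L i x - c) + c \<in> inv_op (As i) (u i) + inv_op (Bs i) (u i)"
      by (intro set_plus_intro) (auto simp: inv_op_def)
    then show ?thesis by (simp add: parallel_sum_def inv_op_def)
  qed
  then have "(\<Sum>i=1..m. adjoint (L i) (u i))
      \<in> (\<Sum>i=1..m. adjoint (L i) ` parallel_sum (As i) (Bs i) (L i x))"
    unfolding set_sum_alt[OF finite_atLeastAtMost] by blast
  then have "- (B x + (\<Sum>i=1..m. adjoint (L i) (u i))) + (\<Sum>i=1..m. adjoint (L i) (u i)) + B x
      \<in> primal_op m A B As Bs L x"
    unfolding primal_op_def using u(1) by (intro set_plus_intro) auto
  then show "solves_primal m A B As Bs L x" by (simp add: solves_primal_def algebra_simps)
qed

text \<open>The primal point \<open>x\<close> itself lies in the inverse of \<open>A + B\<close> at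
  the required argument, and \<open>- L i x + (L i x - c) + c\<close> is the zero sought.\<close>

lemma solves_dualI:
  assumes "\<And>i. i \<in> {1..m} \<Longrightarrow> v i \<in> G i"
    and "- (B x + (\<Sum>i=1..m. adjoint (L i) (v i))) \<in> A x"
    and "\<And>i. i \<in> {1..m} \<Longrightarrow> \<exists>c. v i \<in> Bs i c \<and> v i \<in> As i (L i x - c)"
  shows "solves_dual m G A B As Bs L v"
  unfolding solves_dual_def
proof (intro ballI conjI)
  fix i assume i: "i \<in> {1..m}"
  let ?X = "inv_op (\<lambda>x. A x + {B x}) (- (\<Sum>j=1..m. adjoint (L j) (v j)))"
  have "- (B x + (\<Sum>i=1..m. adjoint (L i) (v i))) + B x \<in> A x + {B x}"
    using assms(2) by (intro set_plus_intro) auto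
  then have "x \<in> ?X" by (simp add: inv_op_def algebra_simps)
  moreover obtain c where "v i \<in> Bs i c" "v i \<in> As i (L i x - c)" using assms(3)[OF i] by blast
  ultimately have "- L i x + (L i x - c) + c
      \<in> (\<lambda>x. - L i x) ` ?X + inv_op (As i) (v i) + inv_op (Bs i) (v i)"
    by (intro set_plus_intro) (auto simp: inv_op_def)
  then show "0 \<in> (\<lambda>x. - L i x) ` ?X + inv_op (As i) (v i) + inv_op (Bs i) (v i)" by simp
qed (use assms(1) in blast)

theorem corollary4p2:
  fixes A :: "'h::{real_inner, complete_space} \<Rightarrow> 'h set"
    and B :: "'h \<Rightarrow> 'h"
    and m :: nat
    and G :: "nat \<Rightarrow> 'g::real_inner set"
    and As Bs :: "nat \<Rightarrow> 'g \<Rightarrow> 'g set"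
    and L :: "nat \<Rightarrow> 'h \<Rightarrow> 'g"
    and \<mu> :: "nat \<Rightarrow> real"
    and \<gamma> :: real
    and x :: "int \<Rightarrow> 'h"
    and v :: "nat \<Rightarrow> int \<Rightarrow> 'g"
  assumes A: "maximally_monotone_on UNIV A"
    and B_mono: "monotone_op (\<lambda>x. {B x})"
    and B_lip: "(\<mu> 0)-lipschitz_on UNIV B"
    and m: "m \<ge> 1"
    and G: "\<And>i. i \<in> {1..m} \<Longrightarrow> subspace (G i) \<and> complete (G i)"
    and As: "\<And>i. i \<in> {1..m} \<Longrightarrow> maximally_monotone_on (G i) (As i)"
    and Bs: "\<And>i. i \<in> {1..m} \<Longrightarrow> maximally_monotone_on (G i) (Bs i)"
    and Bs_lip: "\<And>i. i \<in> {1..m} \<Longrightarrow> lipschitzian_op_on (\<mu> i) (G i) (inv_op (Bs i))"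
    and L: "\<And>i. i \<in> {1..m} \<Longrightarrow> bounded_linear (L i) \<and> range (L i) \<subseteq> G i"
    and L_nonzero: "(\<Sum>i=1..m. (onorm (L i))\<^sup>2) \<noteq> 0"
    and zero_in_ran: "0 \<in> ran_op (primal_op m A B As Bs L)"
    and \<gamma>: "0 < \<gamma>"
      "\<gamma> < (sqrt 2 - 1) / (Max (\<mu> ` {0..m}) + sqrt (\<Sum>i=1..m. (onorm (L i))\<^sup>2))"
    and v_init: "\<And>i. i \<in> {1..m} \<Longrightarrow> v i 0 \<in> G i \<and> v i (- 1) \<in> G i"
    and x_step: "\<And>n::nat. x (int n + 1) =
      resolvent (scale_op \<gamma> A)
        (x (int n) - \<gamma> *\<^sub>R B (2 *\<^sub>R x (int n) - x (int n - 1))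
          - \<gamma> *\<^sub>R (\<Sum>i=1..m. adjoint (L i) (2 *\<^sub>R v i (int n) - v i (int n - 1))))"
    and v_step: "\<And>i (n::nat). i \<in> {1..m} \<Longrightarrow> v i (int n + 1) =
      resolvent (scale_op \<gamma> (inv_op (As i)))
        (v i (int n) - \<gamma> *\<^sub>R value_op (inv_op (Bs i)) (2 *\<^sub>R v i (int n) - v i (int n - 1))
          + \<gamma> *\<^sub>R L i (2 *\<^sub>R x (int n) - x (int n - 1)))"
  shows "(\<exists>xbar. weakly_converges (\<lambda>n. x (int n)) xbar \<and> solves_primal m A B As Bs L xbar) \<and>
    (\<exists>vbar. weakly_converges_direct_sum {1..m} G (\<lambda>n i. v i (int n)) vbar \<and>
       solves_dual m G A B As Bs L vbar)"
proof -
  define I where "I = {1..m}"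
  have I: "finite I" by (simp add: I_def)
  note G = G[folded I_def] and As = As[folded I_def] and Bs = Bs[folded I_def]
    and Bs_lip = Bs_lip[folded I_def] and v_init = v_init[folded I_def]
    and x_step = x_step[folded I_def] and v_step = v_step[folded I_def]
    and \<gamma> = \<gamma>[folded I_def] and L_nonzero = L_nonzero[folded I_def]
  have bl: "bounded_linear (L i)" and LG: "L i a \<in> G i" if "i \<in> I" for i a
    using L that by (auto simp: I_def)
  have sub: "subspace (G i)" and comp: "complete (G i)" if "i \<in> I" for i using G that by auto
  have As_inv: "maximally_monotone_on (G i) (inv_op (As i))" if "i \<in> I" for i
    using As[OF that] by (rule maximally_monotone_on_inv_op)

  \<comment> \<open>The product space and its two operators\<close>
  define D where "D = direct_sum I G"
  define S where "S = (UNIV :: 'h set) \<times> D"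
  have S: "subspace S" "complete S"
    unfolding S_def D_def
    by (intro subspace_Times complete_Times subspace_UNIV complete_UNIV
        subspace_direct_sum complete_direct_sum I G sub; simp)+
  define Bi where "Bi i = value_op (inv_op (Bs i))" for i
  have Bi: "Bi i w \<in> G i" "inv_op (Bs i) w = {Bi i w}" if i: "i \<in> I" and w: "w \<in> G i" for i w
  proof -
    obtain y where "y \<in> G i" "inv_op (Bs i) w = {y}"
      using Bs_lip[OF i] w unfolding lipschitzian_op_on_def by blast
    then show "Bi i w \<in> G i" "inv_op (Bs i) w = {Bi i w}" by (auto simp: Bi_def value_op_def)
  qed
  have Bs_iff: "w \<in> Bs i c \<longleftrightarrow> c = Bi i w" if "i \<in> I" "w \<in> G i" for i w c
    using Bi(2)[OF that] by (auto simp: inv_op_def)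
  have Bi_mono: "0 \<le> (w - w') \<bullet> (Bi i w - Bi i w')" if "i \<in> I" "w \<in> G i" "w' \<in> G i" for i w w'
  proof -
    have "monotone_op (Bs i)" using Bs[OF that(1)] by (simp add: maximally_monotone_on_def)
    from monotone_opD[OF this, of w "Bi i w" w' "Bi i w'"] show ?thesis
      using that by (simp add: Bs_iff inner_commute)
  qed
  have Bi_lip: "norm (Bi i w - Bi i w') \<le> \<mu> i * norm (w - w')" if "i \<in> I" "w \<in> G i" "w' \<in> G i" for i w w'
    using Bs_lip[OF that(1)] lipschitz_onD[of "\<mu> i" "G i" "Bi i" w w'] that
    by (simp add: lipschitzian_op_on_def Bi_def dist_norm)
  \<comment> \<open>Swapping the arguments of \<open>As i\<close> encodes its inverse; the
    conditions on \<open>D\<close> confine the graph to \<open>S \<times> S\<close>.\<close>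
  define M where "M p = {q. fst q \<in> A (fst p) \<and> snd p \<in> D \<and> snd q \<in> D \<and>
    (\<forall>i\<in>I. lookup (snd p) i \<in> As i (lookup (snd q) i))}" for p :: "'h \<times> (nat \<Rightarrow>\<^sub>0 'g)"
  define Q where "Q p = (B (fst p) + (\<Sum>i\<in>I. adjoint (L i) (lookup (snd p) i)),
    family I (\<lambda>i. Bi i (lookup (snd p) i) - L i (fst p)))" for p :: "'h \<times> (nat \<Rightarrow>\<^sub>0 'g)"
  have DG: "lookup f i \<in> G i" if "f \<in> D" "i \<in> I" for f i using that by (simp add: D_def direct_sum_def)
  have fD: "family I f \<in> D" if "\<And>i. i \<in> I \<Longrightarrow> f i \<in> G i" for f
    unfolding D_def using I that by (rule family_in_direct_sum)
  have D_minus: "f - g \<in> D" if "f \<in> D" "g \<in> D" for f g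
    unfolding D_def using that subspace_direct_sum[of I G] G by (intro subspace_diff) (auto simp: D_def)
  have inner_D: "f \<bullet> g = (\<Sum>i\<in>I. lookup f i \<bullet> lookup g i)" if "f \<in> D" for f g
    using I that unfolding D_def by (rule inner_direct_sum)
  have norm_D: "(norm (a, f))\<^sup>2 = (norm a)\<^sup>2 + (\<Sum>i\<in>I. (norm (lookup f i))\<^sup>2)" if "f \<in> D" for a :: 'h and f
    using inner_D[OF that, of f] by (simp add: power2_norm_eq_inner)
  have QS: "Q \<in> S \<rightarrow> S"
    using Bi(1) LG DG sub by (auto simp: Q_def S_def intro!: fD subspace_diff)
  have M_mono: "monotone_op M"
    unfolding monotone_op_def gra_op_def
  proof clarify
    fix a f a' f' b g b' g'
    assume 1: "(b, g) \<in> M (a, f)" and 2: "(b', g') \<in> M (a', f')"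
    have "0 \<le> (a - a') \<bullet> (b - b')"
      using A 1 2 by (intro monotone_opD[of A]) (auto simp: M_def maximally_monotone_on_def)
    moreover have "0 \<le> (lookup f i - lookup f' i) \<bullet> (lookup g i - lookup g' i)" if "i \<in> I" for i
      using As[OF that] 1 2 that monotone_opD[of "As i" "lookup f i" "lookup g i" "lookup f' i" "lookup g' i"]
      by (auto simp: M_def maximally_monotone_on_def inner_commute)
    moreover have "f - f' \<in> D" using 1 2 by (intro D_minus) (auto simp: M_def)
    ultimately show "0 \<le> ((a, f) - (a', f')) \<bullet> ((b, g) - (b', g'))"
      by (auto simp: inner_D lookup_minus intro!: add_nonneg_nonneg sum_nonneg)
  qed
  have M_gra: "gra_op M \<subseteq> S \<times> S" by (auto simp: gra_op_def M_def S_def)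
  have M_J: "\<exists>p\<in>S. (1 / \<gamma>) *\<^sub>R (w - p) \<in> M p" if "w \<in> S" for w
  proof -
    have wD: "snd w \<in> D" using that by (auto simp: S_def)
    note r = resolvent_scale_op[OF sub comp As_inv \<gamma>(1) DG[OF wD]]
    define g where "g = family I (\<lambda>i. resolvent (scale_op \<gamma> (inv_op (As i))) (lookup (snd w) i))"
    have gD: "g \<in> D" unfolding g_def using r(1) by (intro fD)
    have "(1 / \<gamma>) *\<^sub>R (w - (resolvent (scale_op \<gamma> A) (fst w), g)) \<in> M (resolvent (scale_op \<gamma> A) (fst w), g)"
      unfolding M_def
    proof (intro CollectI conjI ballI)
      show "snd ((1 / \<gamma>) *\<^sub>R (w - (resolvent (scale_op \<gamma> A) (fst w), g))) \<in> D"
        using D_minus[OF wD gD] subspace_direct_sum[of I G] G by (auto simp: D_def intro!: subspace_scale)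
      show "fst ((1 / \<gamma>) *\<^sub>R (w - (resolvent (scale_op \<gamma> A) (fst w), g)))
          \<in> A (fst (resolvent (scale_op \<gamma> A) (fst w), g))"
        using resolvent_scale_op(2)[OF subspace_UNIV complete_UNIV A \<gamma>(1) UNIV_I] by simp
      show "lookup (snd (resolvent (scale_op \<gamma> A) (fst w), g)) i
          \<in> As i (lookup (snd ((1 / \<gamma>) *\<^sub>R (w - (resolvent (scale_op \<gamma> A) (fst w), g)))) i)" if "i \<in> I" for i
        using r(2)[OF that that that that] that I by (simp add: g_def inv_op_def lookup_minus)
    qed (use gD in simp)
    then show ?thesis using gD by (intro bexI[of _ "(resolvent (scale_op \<gamma> A) (fst w), g)"]) (auto simp: S_def)
  qed

  \<comment> \<open>Monotonicity and Lipschitz constant of \<open>Q\<close>\<close>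
  have Q_mono: "0 \<le> (Q p - Q q) \<bullet> (p - q)" if pq: "p \<in> S" "q \<in> S" for p q
  proof -
    define d where "d = fst p - fst q"
    define e where "e i = lookup (snd p) i - lookup (snd q) i" for i
    have D: "snd p \<in> D" "snd q \<in> D" using pq by (auto simp: S_def)
    have "(Q p - Q q) \<bullet> (p - q) = (B (fst p) - B (fst q)) \<bullet> d
        + (\<Sum>i\<in>I. (adjoint (L i) (lookup (snd p) i) - adjoint (L i) (lookup (snd q) i)) \<bullet> d)
        + (\<Sum>i\<in>I. (Bi i (lookup (snd p) i) - Bi i (lookup (snd q) i) - (L i (fst p) - L i (fst q))) \<bullet> e i)"
      using D_minus[of "snd (Q p)" "snd (Q q)"] QS pq I
      by (subst inner_prod_def, subst inner_D)
        (auto simp: S_def Pi_iff mem_Times_iff Q_def d_def e_def lookup_minus inner_sum_left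
          sum_subtractf sum.distrib algebra_simps)
    \<comment> \<open>Skewness: the adjoint terms become the negatives of the \<open>L i\<close>
      terms in the other sum, and both cancel.\<close>
    also have "(\<Sum>i\<in>I. (adjoint (L i) (lookup (snd p) i) - adjoint (L i) (lookup (snd q) i)) \<bullet> d)
        = (\<Sum>i\<in>I. (L i (fst p) - L i (fst q)) \<bullet> e i)"
    proof (rule sum.cong[OF refl])
      fix i assume i: "i \<in> I"
      interpret bounded_linear "L i" using bl[OF i] .
      have "(adjoint (L i) (lookup (snd p) i) - adjoint (L i) (lookup (snd q) i)) \<bullet> d = L i d \<bullet> e i"
        by (simp add: e_def inner_commute[of _ d] adjoint_inner[OF bl[OF i]] adjoint_diff[OF bl[OF i]])
      then show "(adjoint (L i) (lookup (snd p) i) - adjoint (L i) (lookup (snd q) i)) \<bullet> d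
          = (L i (fst p) - L i (fst q)) \<bullet> e i" by (simp add: d_def diff)
    qed
    finally have "(Q p - Q q) \<bullet> (p - q) = (B (fst p) - B (fst q)) \<bullet> d
        + (\<Sum>i\<in>I. (Bi i (lookup (snd p) i) - Bi i (lookup (snd q) i)) \<bullet> e i)"
      by (simp add: sum_subtractf sum.distrib algebra_simps)
    moreover have "0 \<le> (B (fst p) - B (fst q)) \<bullet> d"
      using monotone_opD[OF B_mono, of "B (fst p)" "fst p" "B (fst q)" "fst q"] by (simp add: d_def inner_commute)
    moreover have "0 \<le> (\<Sum>i\<in>I. (Bi i (lookup (snd p) i) - Bi i (lookup (snd q) i)) \<bullet> e i)"
      using Bi_mono DG D by (intro sum_nonneg) (simp add: e_def inner_commute)
    ultimately show ?thesis by simp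
  qed
  define \<beta> where "\<beta> = Max (\<mu> ` {0..m})"
  define \<nu> where "\<nu> = sqrt (\<Sum>i\<in>I. (onorm (L i))\<^sup>2)"
  have mu_le: "\<mu> i \<le> \<beta>" if "i \<le> m" for i unfolding \<beta>_def using that by (intro Max_ge) auto
  have beta0: "0 \<le> \<beta>" using mu_le[of 0] lipschitz_on_nonneg[OF B_lip] by simp
  have lam0: "0 < \<nu>"
    using L_nonzero sum_nonneg[of I "\<lambda>i. (onorm (L i))\<^sup>2"] by (simp add: \<nu>_def order_less_le)
  have lam2: "\<nu>\<^sup>2 = (\<Sum>i\<in>I. (onorm (L i))\<^sup>2)" unfolding \<nu>_def by (simp add: sum_nonneg)
  have Q_lip: "(\<beta> + \<nu>)-lipschitz_on S Q"
  proof (rule lipschitz_onI)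
    fix p q assume pq: "p \<in> S" "q \<in> S"
    then have D: "snd p \<in> D" "snd q \<in> D" by (auto simp: S_def)
    define d where "d = fst p - fst q"
    define e where "e i = lookup (snd p) i - lookup (snd q) i" for i
    have N: "(norm (p - q))\<^sup>2 = (norm d)\<^sup>2 + (\<Sum>i\<in>I. (norm (e i))\<^sup>2)"
      using norm_D[OF D_minus[OF D], of d] by (simp add: d_def e_def lookup_minus minus_prod_def)
    \<comment> \<open>\<open>T\<close> collects the diagonal part, controlled by the largest
      Lipschitz constant \<open>\<beta>\<close>, and \<open>K\<close> the skew linear part, with
      norm bound \<open>\<nu>\<close> by Cauchy-Schwarz in the first component and operator norms in
      the others.\<close>
    define T where "T = (B (fst p) - B (fst q), family I (\<lambda>i. Bi i (lookup (snd p) i) - Bi i (lookup (snd q) i)))"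
    define K where "K = ((\<Sum>i\<in>I. adjoint (L i) (e i)), family I (\<lambda>i. - L i d))"
    have "Q p - Q q = T + K"
    proof (rule prod_eqI)
      show "fst (Q p - Q q) = fst (T + K)"
        by (simp add: Q_def T_def K_def e_def adjoint_diff bl sum_subtractf)
      have Ld: "L i d = L i (fst p) - L i (fst q)" if "i \<in> I" for i
        unfolding d_def by (rule bounded_linear.linear[OF bl[OF that], THEN linear_diff])
      show "snd (Q p - Q q) = snd (T + K)"
        using I by (intro poly_mapping_eqI) (simp add: Q_def T_def K_def lookup_minus lookup_add Ld)
    qed
    moreover have "norm T \<le> \<beta> * norm (p - q)"
    proof (rule power2_le_imp_le)
      have "(norm T)\<^sup>2 = (norm (B (fst p) - B (fst q)))\<^sup>2
          + (\<Sum>i\<in>I. (norm (Bi i (lookup (snd p) i) - Bi i (lookup (snd q) i)))\<^sup>2)"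
        unfolding T_def using I DG D Bi(1) sub by (subst norm_D) (auto intro!: fD subspace_diff)
      also have "\<dots> \<le> (\<beta> * norm d)\<^sup>2 + (\<Sum>i\<in>I. (\<beta> * norm (e i))\<^sup>2)"
      proof (intro add_mono sum_mono power_mono norm_ge_zero)
        have "norm (B (fst p) - B (fst q)) \<le> \<mu> 0 * norm d"
          using lipschitz_onD[OF B_lip] by (simp add: d_def dist_norm)
        also have "\<dots> \<le> \<beta> * norm d" using mu_le[of 0] by (intro mult_right_mono) auto
        finally show "norm (B (fst p) - B (fst q)) \<le> \<beta> * norm d" .
        fix i assume i: "i \<in> I"
        have "norm (Bi i (lookup (snd p) i) - Bi i (lookup (snd q) i)) \<le> \<mu> i * norm (e i)"
          using Bi_lip[OF i] DG D i by (simp add: e_def)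
        also have "\<dots> \<le> \<beta> * norm (e i)" using mu_le[of i] i by (intro mult_right_mono) (auto simp: I_def)
        finally show "norm (Bi i (lookup (snd p) i) - Bi i (lookup (snd q) i)) \<le> \<beta> * norm (e i)" .
      qed
      also have "\<dots> = (\<beta> * norm (p - q))\<^sup>2"
        by (simp add: power_mult_distrib N distrib_left sum_distrib_left)
      finally show "(norm T)\<^sup>2 \<le> (\<beta> * norm (p - q))\<^sup>2" .
    qed (use beta0 in simp)
    moreover have "norm K \<le> \<nu> * norm (p - q)"
    proof (rule power2_le_imp_le)
      have "(norm K)\<^sup>2 = (norm (\<Sum>i\<in>I. adjoint (L i) (e i)))\<^sup>2 + (\<Sum>i\<in>I. (norm (L i d))\<^sup>2)"
        unfolding K_def using I LG sub by (subst norm_D) (auto intro!: fD subspace_neg)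
      also have "\<dots> \<le> \<nu>\<^sup>2 * (\<Sum>i\<in>I. (norm (e i))\<^sup>2) + \<nu>\<^sup>2 * (norm d)\<^sup>2"
      proof (rule add_mono)
        have "norm (\<Sum>i\<in>I. adjoint (L i) (e i)) \<le> (\<Sum>i\<in>I. onorm (L i) * norm (e i))"
          using bl by (intro sum_norm_le norm_adjoint_le)
        then have "(norm (\<Sum>i\<in>I. adjoint (L i) (e i)))\<^sup>2 \<le> (\<Sum>i\<in>I. onorm (L i) * norm (e i))\<^sup>2"
          by (rule power_mono) simp
        also have "\<dots> \<le> (\<Sum>i\<in>I. (onorm (L i))\<^sup>2) * (\<Sum>i\<in>I. (norm (e i))\<^sup>2)"
          by (rule Cauchy_Schwarz_ineq_sum)
        finally show "(norm (\<Sum>i\<in>I. adjoint (L i) (e i)))\<^sup>2 \<le> \<nu>\<^sup>2 * (\<Sum>i\<in>I. (norm (e i))\<^sup>2)"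
          by (simp add: lam2)
        have "(\<Sum>i\<in>I. (norm (L i d))\<^sup>2) \<le> (\<Sum>i\<in>I. (onorm (L i) * norm d)\<^sup>2)"
          using bl by (intro sum_mono power_mono onorm) auto
        then show "(\<Sum>i\<in>I. (norm (L i d))\<^sup>2) \<le> \<nu>\<^sup>2 * (norm d)\<^sup>2"
          by (simp add: lam2 power_mult_distrib sum_distrib_right)
      qed
      also have "\<dots> = (\<nu> * norm (p - q))\<^sup>2" by (simp add: N algebra_simps)
      finally show "(norm K)\<^sup>2 \<le> (\<nu> * norm (p - q))\<^sup>2" .
    qed (use lam0 in simp)
    ultimately show "dist (Q p) (Q q) \<le> (\<beta> + \<nu>) * dist p q"
      using norm_triangle_ineq[of T K] by (simp add: dist_norm algebra_simps)
  qed (use beta0 lam0 in simp)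
  \<comment> \<open>Nonzero \<open>L\<close> makes \<open>\<nu>\<close>, hence the denominator in
    the bound on \<open>\<gamma>\<close>, positive.\<close>
  have gm: "\<gamma> * (\<beta> + \<nu>) < sqrt 2 - 1"
    using \<gamma>(2) beta0 lam0 unfolding \<beta>_def[symmetric] \<nu>_def[symmetric]
    by (subst (asm) pos_less_divide_eq) auto

  \<comment> \<open>Zeros of \<open>M + Q\<close> and primal-dual solutions\<close>
  have zero_iff: "- Q (a, f) \<in> M (a, f) \<longleftrightarrow>
      - (B a + (\<Sum>i\<in>I. adjoint (L i) (lookup f i))) \<in> A a \<and>
      (\<forall>i\<in>I. lookup f i \<in> As i (L i a - Bi i (lookup f i)))" if "f \<in> D" for a f
  proof -
    have "- snd (Q (a, f)) \<in> D"
      using QS that subspace_direct_sum[of I G] G by (auto simp: D_def S_def Pi_iff mem_Times_iff intro!: subspace_neg)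
    then show ?thesis using that I by (simp add: M_def Q_def)
  qed
  obtain p where p: "p \<in> S" "- Q p \<in> M p"
  proof -
    obtain a where "solves_primal m A B As Bs L a"
      using zero_in_ran by (auto simp: ran_op_def solves_primal_def)
    then obtain u where u: "- (B a + (\<Sum>i\<in>I. adjoint (L i) (u i))) \<in> A a"
      and uc: "\<And>i. i \<in> I \<Longrightarrow> \<exists>c. u i \<in> Bs i c \<and> u i \<in> As i (L i a - c)"
      unfolding solves_primal_iff I_def by blast
    have uG: "u i \<in> G i" if "i \<in> I" for i
      using uc[OF that] Bs[OF that] by (auto simp: maximally_monotone_on_def gra_op_def)
    have "\<forall>i\<in>I. u i \<in> As i (L i a - Bi i (u i))" using uc uG by (metis Bs_iff)
    then have "- Q (a, family I u) \<in> M (a, family I u)"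
      using u I uG by (subst zero_iff) (auto intro!: fD)
    then show ?thesis using that[of "(a, family I u)"] uG by (auto simp: S_def intro!: fD)
  qed

  \<comment> \<open>The iteration in the product space\<close>
  have vG: "v i (int n) \<in> G i \<and> v i (int n - 1) \<in> G i" if i: "i \<in> I" for i n
  proof (induction n)
    case (Suc n)
    have "v i (int n + 1) \<in> G i"
      unfolding v_step[OF i]
      using Suc LG[OF i] Bi(1)[OF i] sub[OF i]
      by (intro resolvent_scale_op(1)[OF sub[OF i] comp[OF i] As_inv[OF i] \<gamma>(1)] subspace_add subspace_diff
          subspace_scale) (auto simp: Bi_def[symmetric] intro!: subspace_diff subspace_scale)
    then show ?case using Suc by (simp add: add.commute)
  qed (use v_init[OF i] in simp)
  \<comment> \<open>shifted by one, so that \<open>z 0\<close> holds the initial data with index \<open>-1\<close>\<close>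
  define z where "z n = (x (int n - 1), family I (\<lambda>i. v i (int n - 1)))" for n
  have zS: "z n \<in> S" for n using vG by (auto simp: z_def S_def intro!: fD)
  have z_step: "(1 / \<gamma>) *\<^sub>R (z (Suc n) - \<gamma> *\<^sub>R Q (2 *\<^sub>R z (Suc n) - z n) - z (Suc (Suc n))) \<in> M (z (Suc (Suc n)))"
    (is "?q \<in> _") for n
  proof -
    let ?y = "2 *\<^sub>R z (Suc n) - z n"
    have yS: "?y \<in> S" using zS S(1) by (simp add: subspace_diff subspace_scale)
    have "?q \<in> S"
      using zS yS QS S(1) by (intro subspace_scale subspace_diff) auto
    then have qD: "snd ?q \<in> D" unfolding S_def mem_Times_iff by blast
    have vy: "lookup (snd ?y) i = 2 *\<^sub>R v i (int n) - v i (int n - 1)" if "i \<in> I" for i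
      using that I by (simp add: z_def lookup_minus)
    have zSS: "z (Suc (Suc n)) = (x (int n + 1), family I (\<lambda>i. v i (int n + 1)))"
      by (simp add: z_def add.commute)
    have 1: "fst ?q \<in> A (x (int n + 1))"
    proof -
      let ?w = "x (int n) - \<gamma> *\<^sub>R B (2 *\<^sub>R x (int n) - x (int n - 1))
        - \<gamma> *\<^sub>R (\<Sum>i\<in>I. adjoint (L i) (2 *\<^sub>R v i (int n) - v i (int n - 1)))"
      have "fst ?q = (1 / \<gamma>) *\<^sub>R (?w - x (int n + 1))"
        unfolding zSS by (simp add: Q_def vy algebra_simps del: snd_diff) (simp add: z_def algebra_simps)
      moreover have "(1 / \<gamma>) *\<^sub>R (?w - x (int n + 1)) \<in> A (x (int n + 1))"
        unfolding x_step by (rule resolvent_scale_op(2)[OF subspace_UNIV complete_UNIV A \<gamma>(1) UNIV_I])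
      ultimately show ?thesis by (simp only:)
    qed
    have 2: "v i (int n + 1) \<in> As i (lookup (snd ?q) i)" if i: "i \<in> I" for i
    proof -
      let ?w = "v i (int n) - \<gamma> *\<^sub>R Bi i (2 *\<^sub>R v i (int n) - v i (int n - 1)) + \<gamma> *\<^sub>R L i (2 *\<^sub>R x (int n) - x (int n - 1))"
      have "2 *\<^sub>R v i (int n) - v i (int n - 1) \<in> G i"
        using vG[OF i] by (intro subspace_diff subspace_scale sub[OF i]) auto
      then have "?w \<in> G i"
        using vG[OF i] LG[OF i] Bi(1)[OF i] by (intro subspace_add subspace_diff subspace_scale sub[OF i]) auto
      from resolvent_scale_op(2)[OF sub[OF i] comp[OF i] As_inv[OF i] \<gamma>(1) this]
      have "(1 / \<gamma>) *\<^sub>R (?w - v i (int n + 1)) \<in> inv_op (As i) (v i (int n + 1))"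
        unfolding Bi_def v_step[OF i] .
      moreover have "lookup (snd ?q) i = (1 / \<gamma>) *\<^sub>R (?w - v i (int n + 1))"
        unfolding zSS using i I by (simp add: Q_def z_def lookup_minus lookup_add algebra_simps)
      ultimately show ?thesis by (simp only: inv_op_def mem_Collect_eq)
    qed
    show ?thesis
      unfolding M_def
    proof (intro CollectI conjI ballI)
      show "fst ?q \<in> A (fst (z (Suc (Suc n))))" using 1 unfolding zSS fst_conv .
      show "snd (z (Suc (Suc n))) \<in> D" using zS[of "Suc (Suc n)"] by (auto simp: S_def)
      show "lookup (snd (z (Suc (Suc n)))) i \<in> As i (lookup (snd ?q) i)" if "i \<in> I" for i
      proof -
        have "lookup (snd (z (Suc (Suc n)))) i = v i (int n + 1)" using that I unfolding zSS by simp
        then show ?thesis using 2[OF that] by (simp only:)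
      qed
    qed (rule qD)
  qed

  \<comment> \<open>Weak convergence of the primal and dual components\<close>
  obtain l where l: "l \<in> S" "- Q l \<in> M l" "\<And>w. w \<in> S \<Longrightarrow> (\<lambda>n. z n \<bullet> w) \<longlonglongrightarrow> l \<bullet> w"
  proof (rule reflected_forward_backward[where z = z and M = M and Q = Q,
        OF S M_mono M_gra M_J Q_lip QS Q_mono \<gamma>(1) gm p zS z_step])
  qed blast+
  define xbar where "xbar = fst l"
  define vbar where "vbar = lookup (snd l)"
  have lD: "snd l \<in> D" using l(1) by (auto simp: S_def)
  have zero: "- (B xbar + (\<Sum>i\<in>I. adjoint (L i) (vbar i))) \<in> A xbar"
    "\<And>i. i \<in> I \<Longrightarrow> vbar i \<in> As i (L i xbar - Bi i (vbar i))"
    using l(2) zero_iff[OF lD, of "fst l"] by (auto simp: xbar_def vbar_def)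
  have vbarG: "vbar i \<in> G i" if "i \<in> I" for i using DG[OF lD that] by (simp add: vbar_def)
  have c: "\<exists>c. vbar i \<in> Bs i c \<and> vbar i \<in> As i (L i xbar - c)" if "i \<in> I" for i
    using zero(2)[OF that] Bs_iff[OF that vbarG[OF that]] by blast
  \<comment> \<open>Undoes the shift: \<open>z (Suc n)\<close> holds the iterates with index
    \<open>n\<close>. Test vectors supported in one factor then separate the two components.\<close>
  have zl: "(\<lambda>n. z (Suc n) \<bullet> w) \<longlonglongrightarrow> l \<bullet> w" if "w \<in> S" for w
    using l(3)[OF that] by (rule LIMSEQ_Suc)
  have "weakly_converges (\<lambda>n. x (int n)) xbar"
    unfolding weakly_converges_def
  proof
    fix w
    have "(w, 0) \<in> S" using sub by (auto simp: S_def D_def direct_sum_def subspace_0)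
    from zl[OF this] show "(\<lambda>n. x (int n) \<bullet> w) \<longlonglongrightarrow> xbar \<bullet> w" by (simp add: z_def xbar_def inner_prod_def)
  qed
  moreover have "weakly_converges_direct_sum I G (\<lambda>n i. v i (int n)) vbar"
    unfolding weakly_converges_direct_sum_def
  proof (intro conjI allI ballI)
    fix w assume "w \<in> Pi I G"
    then have wD: "family I w \<in> D" by (intro fD) auto
    then have "(0, family I w) \<in> S" by (simp add: S_def)
    moreover have inner_w: "p \<bullet> (0, family I w) = (\<Sum>i\<in>I. lookup (snd p) i \<bullet> w i)" if "p \<in> S" for p
      using inner_D[of "snd p"] that I by (auto simp: S_def inner_prod_def)
    moreover have "z (Suc n) \<bullet> (0, family I w) = (\<Sum>i\<in>I. v i (int n) \<bullet> w i)" for n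
      unfolding inner_w[OF zS] using I by (simp add: z_def)
    ultimately show "(\<lambda>n. \<Sum>i\<in>I. v i (int n) \<bullet> w i) \<longlonglongrightarrow> (\<Sum>i\<in>I. vbar i \<bullet> w i)"
      using zl[of "(0, family I w)"] l(1) by (simp add: vbar_def)
  qed (use vG vbarG in auto)
  moreover have "solves_primal m A B As Bs L xbar"
    unfolding solves_primal_iff using zero(1) c unfolding I_def by blast
  moreover have "solves_dual m G A B As Bs L vbar"
    using vbarG zero(1) c unfolding I_def by (rule solves_dualI)
  ultimately show ?thesis unfolding I_def by blast
qed

end
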